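(* Let $n\ge2$, $S\in\{1,\dots,n\}$, and $f(x)=\frac1n\sum_{i=1}^n f_i(x)$ with $f_i(x)=\frac12 x^\top A_i x-b_i^\top x$, where $A_i\in\mathbb{R}^{d\times d}$ is symmetric positive semidefinite and $b_i\in\mathbb{R}^d$, the $A_i$ not all zero, and assume there is $x_*$ with $\nabla f_i(x_* )=0$ for all $i$. Let $\eta\ge0$, $\tau>0$, and for $\gamma\ge0$ let $$T_\eta(\gamma,S)=\big(\eta+\tau(\gamma L_{\max}+1)\big)\frac{L_{\gamma,S}}{\mu_\gamma^+},\qquad L_{\gamma,S}=\frac{n-S}{S(n-1)}\frac{L_{\max}}{1+\gamma L_{\max}}+\frac{n(S-1)}{S(n-1)}L_\gamma .$$ Then, up to a constant factor, $T_\eta(\cdot,S)$ is minimized by some $$\gamma\in\left[\frac{1}{\max_i\lambda_{\max}(A_i)},\ \min\left\{\frac{\frac{\eta}{\tau}-1}{\max_i\lambda_{\max}(A_i)},\frac{1}{\min_i\lambda_{\min}^+(A_i)}\right\}\right]\quad\text{if }\frac{\eta}{\tau}\ge2,$$ and by some $$\gamma\in\left[0,\ \max\left\{0,\min\left\{\frac{\frac{\eta}{\tau}-1}{\max_i\lambda_{\max}(A_i)},\frac{1}{\min_i\lambda_{\min}^+(A_i)}\right\}\right\}\right]\quad\text{if }\frac{\eta}{\tau}<2.$$ That is, there is an absolute constant $C$ (independent of the problem data, $S$, $\eta$ and $\tau$) such that in each case some $\gamma$ in the stated interval satisfies $T_\eta(\gamma,S)\le C\inf_{\gamma'\ge0}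T_\eta(\gamma',S)$.
   Context: For a convex function $g$ and $\gamma>0$, the Moreau envelope is $M_g^\gamma(x)=\min_z\{g(z)+\frac1{2\gamma}\|z-x\|^2\}$; $M^\gamma=\frac1n\sum_{i=1}^nM^\gamma_{f_i}$, a quadratic with Hessian $\nabla^2M^\gamma=\frac1n\sum_i\frac1\gamma(I-(\gamma A_i+I)^{-1})$. $L_\gamma$ and $\mu^+_\gamma$ are the largest and the smallest non-zero eigenvalues of $\nabla^2M^\gamma$; for $\gamma=0$ they are replaced by the largest and smallest non-zero eigenvalues of $A=\frac1n\sum_iA_i$. $L_{\max}=\max_i\lambda_{\max}(A_i)$; $\lambda_{\min}^+(A_i)$ is the smallest non-zero eigenvalue of $A_i$, and minima of $\lambda_{\min}^+(A_i)$ are over those $i$ with $A_i\ne0$. $T_\eta(\gamma,S)$ is, up to constant and logarithmic factors, the total time complexity of FedExProx with partial participation ($S$ clients sampled uniformly without replacement per round) when each step costs $\eta+\tau(\gamma L_{\max}+1)$. *)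

theory Defs
  imports "HOL-Analysis.Derivative" "Jordan_Normal_Form.Spectral_Radius"
begin

(* Vectors and matrices carry their dimension d as a number, so that a constant can be quantified
   before (hence be independent of) the dimension. *)

unbundle no inner_syntax

definition psd :: "nat \<Rightarrow> real mat \<Rightarrow> bool" where
  "psd d M \<longleftrightarrow> M \<in> carrier_mat d d \<and> transpose_mat M = M \<and>
     (\<forall>x \<in> carrier_vec d. 0 \<le> x \<bullet> (M *\<^sub>v x))"

definition lambda_max :: "real mat \<Rightarrow> real" where
  "lambda_max M = Max (spectrum M)"

definition lambda_min_pos :: "real mat \<Rightarrow> real" where
  "lambda_min_pos M = Min (spectrum M - {0})"

definition quad :: "real mat \<Rightarrow> real vec \<Rightarrow> real vec \<Rightarrow> real" where
  "quad M b x = 1 / 2 * (x \<bullet> (M *\<^sub>v x)) - b \<bullet> x"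

definition grad :: "nat \<Rightarrow> (real vec \<Rightarrow> real) \<Rightarrow> real vec \<Rightarrow> real vec" where
  "grad d F x = vec d (\<lambda>j. deriv (\<lambda>t. F (x + t \<cdot>\<^sub>v unit_vec d j)) 0)"

definition hessian :: "nat \<Rightarrow> (real vec \<Rightarrow> real) \<Rightarrow> real vec \<Rightarrow> real mat" where
  "hessian d F x = mat d d (\<lambda>(i, j). deriv (\<lambda>t. grad d F (x + t \<cdot>\<^sub>v unit_vec d i) $ j) 0)"

(* The minimum over z is rendered as an infimum; for convex quadratic g and \<gamma> > 0 it is attained. *)
definition moreau :: "nat \<Rightarrow> real \<Rightarrow> (real vec \<Rightarrow> real) \<Rightarrow> real vec \<Rightarrow> real" where
  "moreau d \<gamma> g x = (INF z \<in> carrier_vec d. g z + 1 / (2 * \<gamma>) * ((z - x) \<bullet> (z - x)))"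

definition avg_moreau ::
  "nat \<Rightarrow> nat \<Rightarrow> (nat \<Rightarrow> real mat) \<Rightarrow> (nat \<Rightarrow> real vec) \<Rightarrow> real \<Rightarrow> real vec \<Rightarrow> real" where
  "avg_moreau d n A b \<gamma> x = 1 / real n * (\<Sum>i = 1..n. moreau d \<gamma> (quad (A i) (b i)) x)"

definition avg_mat :: "nat \<Rightarrow> nat \<Rightarrow> (nat \<Rightarrow> real mat) \<Rightarrow> real mat" where
  "avg_mat d n A = mat d d (\<lambda>(j, k). 1 / real n * (\<Sum>i = 1..n. A i $$ (j, k)))"

(* The matrix whose extreme eigenvalues are L_\<gamma> and \<mu>_\<gamma>\<^sup>+.  The envelope of a quadratic is a quadratic,
   so its Hessian is the same at every point and may be taken at the origin. *)
definition curvature ::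
  "nat \<Rightarrow> nat \<Rightarrow> (nat \<Rightarrow> real mat) \<Rightarrow> (nat \<Rightarrow> real vec) \<Rightarrow> real \<Rightarrow> real mat" where
  "curvature d n A b \<gamma> =
     (if \<gamma> = 0 then avg_mat d n A else hessian d (avg_moreau d n A b \<gamma>) (0\<^sub>v d))"

definition L_gamma ::
  "nat \<Rightarrow> nat \<Rightarrow> (nat \<Rightarrow> real mat) \<Rightarrow> (nat \<Rightarrow> real vec) \<Rightarrow> real \<Rightarrow> real" where
  "L_gamma d n A b \<gamma> = lambda_max (curvature d n A b \<gamma>)"

definition mu_gamma ::
  "nat \<Rightarrow> nat \<Rightarrow> (nat \<Rightarrow> real mat) \<Rightarrow> (nat \<Rightarrow> real vec) \<Rightarrow> real \<Rightarrow> real" where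
  "mu_gamma d n A b \<gamma> = lambda_min_pos (curvature d n A b \<gamma>)"

definition L_max :: "nat \<Rightarrow> (nat \<Rightarrow> real mat) \<Rightarrow> real" where
  "L_max n A = (MAX i \<in> {1..n}. lambda_max (A i))"

definition min_lambda_min_pos :: "nat \<Rightarrow> nat \<Rightarrow> (nat \<Rightarrow> real mat) \<Rightarrow> real" where
  "min_lambda_min_pos d n A = (MIN i \<in> {i \<in> {1..n}. A i \<noteq> 0\<^sub>m d d}. lambda_min_pos (A i))"

definition L_gamma_S ::
  "nat \<Rightarrow> nat \<Rightarrow> (nat \<Rightarrow> real mat) \<Rightarrow> (nat \<Rightarrow> real vec) \<Rightarrow> nat \<Rightarrow> real \<Rightarrow> real" where
  "L_gamma_S d n A b S \<gamma> =
     (real n - real S) / (real S * (real n - 1)) * (L_max n A / (1 + \<gamma> * L_max n A))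
     + real n * (real S - 1) / (real S * (real n - 1)) * L_gamma d n A b \<gamma>"

definition time_complexity ::
  "nat \<Rightarrow> nat \<Rightarrow> (nat \<Rightarrow> real mat) \<Rightarrow> (nat \<Rightarrow> real vec) \<Rightarrow> real \<Rightarrow> real \<Rightarrow> real \<Rightarrow> nat \<Rightarrow> real" where
  "time_complexity d n A b \<eta> \<tau> \<gamma> S =
     (\<eta> + \<tau> * (\<gamma> * L_max n A + 1)) * (L_gamma_S d n A b S \<gamma> / mu_gamma d n A b \<gamma>)"

end

theory Submission
  imports Defs
begin

text \<open>
  In an eigenbasis of \<open>A\<^sub>i\<close> the Moreau envelope of \<open>f\<^sub>i\<close> splits into scalar problems, and its Hessian has
  the eigenvalues \<open>\<lambda> / (1 + \<gamma> \<lambda>)\<close>. Hence every inequality between such scalars at two values of \<open>\<gamma>\<close>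
  transfers, by comparison of quadratic forms, to \<open>L_\<gamma>\<close> and \<open>\<mu>_\<gamma>\<^sup>+\<close> (the kernel of the averaged matrix
  does not depend on \<open>\<gamma>\<close>): both are antitone, both become monotone after multiplication by
  \<open>1 + \<gamma> L_max\<close>, and \<open>\<gamma> \<mu>_\<gamma>\<^sup>+\<close> grows by at most a factor 2 beyond the inverse of the smallest nonzero
  eigenvalue. Therefore the cost cannot drop by more than a factor 4 to the left of \<open>1 / L_max\<close>,
  nor by more than a factor 2 to the right of the upper end of the interval, and a point of the
  interval that is optimal there up to a factor 2 is globally optimal up to a factor 8.
\<close>

unbundle no vec_syntax

section \<open>Spectral theory of real symmetric matrices\<close>

lemma scalar_prod_self_nonneg: "0 \<le> x \<bullet> (x :: real vec)"
  unfolding scalar_prod_def by (intro sum_nonneg) auto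

lemma scalar_prod_self_eq_0:
  assumes "(x :: real vec) \<in> carrier_vec n"
  shows "x \<bullet> x = 0 \<longleftrightarrow> x = 0\<^sub>v n"
  using conjugate_square_eq_0_vec[OF assms] by (simp add: conjugate_vec_def vec_eq_iff)

lemma scalar_prod_self_pos:
  assumes "(x :: real vec) \<in> carrier_vec n" "x \<noteq> 0\<^sub>v n"
  shows "0 < x \<bullet> x"
  using scalar_prod_self_eq_0[OF assms(1)] assms(2) scalar_prod_self_nonneg[of x] by linarith

lemma scalar_prod_mult_mat_vec:
  assumes "(A :: 'a :: comm_semiring_0 mat) \<in> carrier_mat m n" "x \<in> carrier_vec m" "y \<in> carrier_vec n"
  shows "x \<bullet> (A *\<^sub>v y) = (transpose_mat A *\<^sub>v x) \<bullet> y"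
  using transpose_vec_mult_scalar[OF assms(1,3,2)] by simp

text \<open>The complexified matrix has an eigenvalue. Symmetry forces it to be real, and then the
  real and imaginary parts of its eigenvector both satisfy the real eigenvalue equation; at least
  one of them is nonzero and can be normalized.\<close>

lemma symmetric_eigenvector_exists:
  fixes A :: "real mat"
  assumes A: "A \<in> carrier_mat n n" and sym: "transpose_mat A = A" and n: "0 < n"
  obtains v k where "v \<in> carrier_vec n" "v \<bullet> v = 1" "A *\<^sub>v v = k \<cdot>\<^sub>v v"
proof -
  let ?C = "map_mat complex_of_real A"
  have C: "?C \<in> carrier_mat n n" using A by simp
  obtain c z where "eigenvector ?C z c"
    using spectrum_non_empty[OF C n] unfolding spectrum_def eigenvalue_def by auto
  hence z: "z \<in> carrier_vec n" "z \<noteq> 0\<^sub>v n" "?C *\<^sub>v z = c \<cdot>\<^sub>v z"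
    using A by (auto simp: eigenvector_def)
  define x where "x = map_vec Re z"
  define y where "y = map_vec Im z"
  have x: "x \<in> carrier_vec n" and y: "y \<in> carrier_vec n" using z by (auto simp: x_def y_def)
  have eq: "(\<Sum>j = 0..<n. complex_of_real (A $$ (i, j)) * z $ j) = c * z $ i" if "i < n" for i
    using arg_cong[OF z(3), of "\<lambda>v. v $ i"] that A z(1) by (simp add: scalar_prod_def)
  have Ax: "A *\<^sub>v x = Re c \<cdot>\<^sub>v x - Im c \<cdot>\<^sub>v y"
  proof (rule eq_vecI)
    fix i assume "i < dim_vec (Re c \<cdot>\<^sub>v x - Im c \<cdot>\<^sub>v y)"
    hence i: "i < n" using y by simp
    show "(A *\<^sub>v x) $ i = (Re c \<cdot>\<^sub>v x - Im c \<cdot>\<^sub>v y) $ i"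
      using arg_cong[OF eq[OF i], of Re] i A z(1) by (simp add: x_def y_def scalar_prod_def)
  qed (use A y in auto)
  have Ay: "A *\<^sub>v y = Im c \<cdot>\<^sub>v x + Re c \<cdot>\<^sub>v y"
  proof (rule eq_vecI)
    fix i assume "i < dim_vec (Im c \<cdot>\<^sub>v x + Re c \<cdot>\<^sub>v y)"
    hence i: "i < n" using y by simp
    show "(A *\<^sub>v y) $ i = (Im c \<cdot>\<^sub>v x + Re c \<cdot>\<^sub>v y) $ i"
      using arg_cong[OF eq[OF i], of Im] i A z(1) by (simp add: x_def y_def scalar_prod_def)
  qed (use A y in auto)
  \<comment> \<open>Substituting the formulas for \<open>A *\<^sub>v x\<close> and
    \<open>A *\<^sub>v y\<close>, the terms with \<open>Re c\<close> cancel and \<open>Im c\<close>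
    times the squared norm of \<open>z\<close> remains.\<close>
  have "x \<bullet> (A *\<^sub>v y) = (A *\<^sub>v x) \<bullet> y"
    using scalar_prod_mult_mat_vec[OF A x y] sym by simp
  hence "Im c * (x \<bullet> x + y \<bullet> y) = 0"
    unfolding Ax Ay using x y
    by (simp add: scalar_prod_add_distrib[of _ n] minus_scalar_prod_distrib[of _ n] algebra_simps)
  moreover have nz: "x \<noteq> 0\<^sub>v n \<or> y \<noteq> 0\<^sub>v n"
  proof (rule ccontr)
    assume "\<not> (x \<noteq> 0\<^sub>v n \<or> y \<noteq> 0\<^sub>v n)"
    hence "x $ i = 0" "y $ i = 0" if "i < n" for i using that by auto
    hence "z $ i = 0" if "i < n" for i using that z(1) by (simp add: x_def y_def complex_eq_iff)
    hence "z = 0\<^sub>v n" using z(1) by (intro eq_vecI) auto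
    with z(2) show False by simp
  qed
  moreover have "0 < x \<bullet> x + y \<bullet> y"
    using nz scalar_prod_self_pos[OF x] scalar_prod_self_pos[OF y]
      scalar_prod_self_nonneg[of x] scalar_prod_self_nonneg[of y] by linarith
  ultimately have "Im c = 0" by simp
  hence Ax': "A *\<^sub>v x = Re c \<cdot>\<^sub>v x" and Ay': "A *\<^sub>v y = Re c \<cdot>\<^sub>v y"
    unfolding Ax Ay using x y by auto
  from nz Ax' Ay' x y obtain u where u: "u \<in> carrier_vec n" "u \<noteq> 0\<^sub>v n" "A *\<^sub>v u = Re c \<cdot>\<^sub>v u" by auto
  have p: "0 < u \<bullet> u" by (rule scalar_prod_self_pos[OF u(1,2)])
  let ?v = "(1 / sqrt (u \<bullet> u)) \<cdot>\<^sub>v u"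
  show thesis
  proof
    show "?v \<in> carrier_vec n" using u by simp
    show "?v \<bullet> ?v = 1" using u p by (simp flip: real_sqrt_mult)
    show "A *\<^sub>v ?v = Re c \<cdot>\<^sub>v ?v"
      using mult_mat_vec[OF A u(1)] u(3) by (simp add: smult_smult_assoc mult.commute)
  qed
qed

text \<open>The Householder reflection exchanging \<open>v\<close> and the first unit vector; if these coincide,
  the division by zero makes it the identity, as wanted.\<close>

lemma symmetric_orthogonal_first_column:
  fixes v :: "real vec"
  assumes v: "v \<in> carrier_vec n" and v1: "v \<bullet> v = 1" and n: "0 < n"
  obtains Q where "Q \<in> carrier_mat n n" "transpose_mat Q = Q" "Q * Q = 1\<^sub>m n" "col Q 0 = v"
proof -
  define w where "w = v - unit_vec n 0"
  define c where "c = 2 / (w \<bullet> w)"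
  define Q where "Q = mat n n (\<lambda>(i, j). (if i = j then 1 else 0) - c * w $ i * w $ j)"
  have w: "w \<in> carrier_vec n" using v by (simp add: w_def)
  have Q: "Q \<in> carrier_mat n n" by (simp add: Q_def)
  \<comment> \<open>This also holds for \<open>w = 0\<close>, where \<open>c = 2 / 0 = 0\<close>. It
    is exactly what makes the terms in \<open>w $ i * w $ j\<close> cancel in
    \<open>Q * Q\<close>.\<close>
  have cw: "c * c * (w \<bullet> w) = 2 * c" by (simp add: c_def)
  have ww: "w \<bullet> w = 2 - 2 * v $ 0"
    unfolding w_def using v v1 n
    by (simp add: minus_scalar_prod_distrib[of _ n] scalar_prod_minus_distrib[of _ n])
  have w0: "w $ 0 = v $ 0 - 1" using n v by (simp add: w_def)
  have "(Q * Q) $$ (i, j) = 1\<^sub>m n $$ (i, j)" if i: "i < n" and j: "j < n" for i j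
  proof -
    have "(Q * Q) $$ (i, j) = (\<Sum>k = 0..<n. ((if i = k then 1 else 0) - c * w $ i * w $ k)
        * ((if k = j then 1 else 0) - c * w $ k * w $ j))"
      using i j by (simp add: Q_def scalar_prod_def)
    also have "\<dots> = (\<Sum>k = 0..<n. (if i = k then (if k = j then 1 else 0) - c * w $ k * w $ j else 0)
        - (if k = j then c * w $ i * w $ k else 0) + c * c * w $ i * w $ j * (w $ k * w $ k))"
      by (intro sum.cong) (auto simp: algebra_simps)
    also have "\<dots> = (if i = j then 1 else 0) - c * w $ i * w $ j - c * w $ i * w $ j
        + c * c * w $ i * w $ j * (w \<bullet> w)"
      using i j w by (simp add: sum.distrib sum_subtractf scalar_prod_def flip: sum_distrib_left)
    also have "\<dots> = (if i = j then 1 else 0) - 2 * c * w $ i * w $ j + c * c * (w \<bullet> w) * w $ i * w $ j"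
      by (simp add: algebra_simps)
    finally show ?thesis unfolding cw using i j by simp
  qed
  hence QQ: "Q * Q = 1\<^sub>m n" using Q by (intro eq_matI) auto
  \<comment> \<open>Column 0 of \<open>Q\<close> is the first unit vector minus
    \<open>c * w $ 0\<close> times \<open>w\<close>; this identity turns it into the first unit
    vector plus \<open>w\<close>, that is, \<open>v\<close>.\<close>
  have cw0: "c * w $ 0 * w $ i = - w $ i" if "i < n" for i
  proof (cases "w \<bullet> w = 0")
    case True
    hence "w = 0\<^sub>v n" using scalar_prod_self_eq_0[OF w] by simp
    thus ?thesis using that by simp
  next
    case False
    hence "c * w $ 0 = - 1" unfolding c_def ww w0 by (simp add: field_simps)
    thus ?thesis by simp
  qed
  have "col Q 0 $ i = v $ i" if "i < n" for i
    using that n cw0[OF that] v by (auto simp: Q_def w_def algebra_simps)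
  hence "col Q 0 = v" using Q v by (intro eq_vecI) auto
  moreover have "transpose_mat Q = Q" by (rule eq_matI) (auto simp: Q_def)
  ultimately show thesis using Q QQ that by blast
qed

text \<open>Deflation by induction on the dimension: a reflection carrying a unit eigenvector to the
  first unit vector conjugates \<open>A\<close> into a block matrix made of the eigenvalue and a
  smaller symmetric matrix.\<close>

theorem spectral_theorem_real_symmetric:
  fixes A :: "real mat"
  assumes "A \<in> carrier_mat n n" "transpose_mat A = A"
  shows "\<exists>P f. P \<in> carrier_mat n n \<and> transpose_mat P * P = 1\<^sub>m n
    \<and> A = P * mat_diag n f * transpose_mat P"
  using assms
proof (induction n arbitrary: A)
  case 0
  have "A = 1\<^sub>m 0 * mat_diag 0 (\<lambda>_. 0) * transpose_mat (1\<^sub>m 0)"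
    using 0 by (intro eq_matI) auto
  thus ?case by (intro exI[of _ "1\<^sub>m 0"] exI[of _ "\<lambda>_. 0"]) auto
next
  case (Suc n)
  note A = Suc.prems(1)
  obtain v k where v: "v \<in> carrier_vec (Suc n)" "v \<bullet> v = 1" "A *\<^sub>v v = k \<cdot>\<^sub>v v"
    using symmetric_eigenvector_exists[OF Suc.prems] by auto
  obtain Q where Q: "Q \<in> carrier_mat (Suc n) (Suc n)" "transpose_mat Q = Q"
      "Q * Q = 1\<^sub>m (Suc n)" "col Q 0 = v"
    using symmetric_orthogonal_first_column[OF v(1,2)] by auto
  define B where "B = Q * A * Q"
  have B: "B \<in> carrier_mat (Suc n) (Suc n)" using A Q by (simp add: B_def)
  have Bt: "transpose_mat B = B"
    using A Q Suc.prems(2) unfolding B_def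
    by (simp add: transpose_mult[of _ "Suc n" "Suc n" _ "Suc n"] assoc_mult_mat[of _ "Suc n" "Suc n" _ "Suc n" _ "Suc n"])
  have Qv: "Q *\<^sub>v v = unit_vec (Suc n) 0"
  proof -
    have "Q *\<^sub>v v = col (Q * Q) 0" using col_mult2[OF Q(1) Q(1), of 0] Q(4) by simp
    thus ?thesis unfolding Q(3) by simp
  qed
  have "col B 0 = (Q * A) *\<^sub>v v" unfolding B_def using Q(4) col_mult2[of "Q * A" "Suc n" "Suc n" Q "Suc n" 0] A Q by simp
  also have "\<dots> = k \<cdot>\<^sub>v unit_vec (Suc n) 0"
    using A Q(1) v mult_mat_vec[OF Q(1) v(1)] by (simp add: Qv)
  finally have col0: "col B 0 = k \<cdot>\<^sub>v unit_vec (Suc n) 0" .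
  have Bi0: "B $$ (i, 0) = (if i = 0 then k else 0)" if "i < Suc n" for i
    using arg_cong[OF col0, of "\<lambda>v. v $ i"] that B by auto
  have B0i: "B $$ (0, i) = (if i = 0 then k else 0)" if "i < Suc n" for i
    using Bi0[OF that] arg_cong[OF Bt, of "\<lambda>M. M $$ (0, i)"] that B by auto
  \<comment> \<open>The first row and column of \<open>B\<close> vanish off the diagonal, so
    \<open>B\<close> consists of the entry \<open>k\<close> and this lower right block.\<close>
  define B' where "B' = mat n n (\<lambda>(i, j). B $$ (Suc i, Suc j))"
  have B': "B' \<in> carrier_mat n n" by (simp add: B'_def)
  have "transpose_mat B' = B'"
  proof (rule eq_matI)
    fix i j assume "i < dim_row B'" "j < dim_col B'"
    thus "transpose_mat B' $$ (i, j) = B' $$ (i, j)"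
      using arg_cong[OF Bt, of "\<lambda>M. M $$ (Suc i, Suc j)"] B by (simp add: B'_def)
  qed (auto simp: B'_def)
  from Suc.IH[OF B' this] obtain P f where P: "P \<in> carrier_mat n n" "transpose_mat P * P = 1\<^sub>m n"
      "B' = P * mat_diag n f * transpose_mat P" by blast
  define K where "K = mat 1 1 (\<lambda>_. k)"
  have K: "K \<in> carrier_mat 1 1" by (simp add: K_def)
  define R where "R = four_block_mat (1\<^sub>m 1) (0\<^sub>m 1 n) (0\<^sub>m n 1) P"
  have R: "R \<in> carrier_mat (Suc n) (Suc n)"
    using four_block_carrier_mat[of "1\<^sub>m 1 :: real mat" 1 1 P n n] P by (simp add: R_def)
  have Rt: "transpose_mat R = four_block_mat (1\<^sub>m 1) (0\<^sub>m 1 n) (0\<^sub>m n 1) (transpose_mat P)"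
    unfolding R_def using P by (subst transpose_four_block_mat[of _ 1 1 _ n _ n]) auto
  have RR: "transpose_mat R * R = 1\<^sub>m (Suc n)"
    unfolding Rt unfolding R_def using P
    by (subst mult_four_block_mat[of _ 1 1 _ n _ n _ _ 1 _ n]) (auto intro!: eq_matI)
  \<comment> \<open>The split-off eigenvalue takes position 0, and the eigenvalues of the block move
    up by one.\<close>
  let ?g = "\<lambda>i. if i = 0 then k else f (i - 1)"
  have D: "mat_diag (Suc n) ?g = four_block_mat K (0\<^sub>m 1 n) (0\<^sub>m n 1) (mat_diag n f)"
    by (rule eq_matI) (auto simp: K_def mat_diag_def)
  have PD: "P * mat_diag n f \<in> carrier_mat n n" using P by (auto intro: mult_carrier_mat[of _ n n])
  hence PD': "P * mat_diag n f * transpose_mat P \<in> carrier_mat n n"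
    using P by (auto intro: mult_carrier_mat[of _ n n])
  have "R * mat_diag (Suc n) ?g * transpose_mat R
      = four_block_mat K (0\<^sub>m 1 n) (0\<^sub>m n 1) (P * mat_diag n f * transpose_mat P)"
  proof -
    have "R * mat_diag (Suc n) ?g = four_block_mat K (0\<^sub>m 1 n) (0\<^sub>m n 1) (P * mat_diag n f)"
      unfolding D R_def using P K left_mult_zero_mat[OF mat_diag_dim[of n f], of 1]
      by (subst mult_four_block_mat[of _ 1 1 _ n _ n _ _ 1 _ n]) auto
    thus ?thesis
      unfolding Rt using P K PD PD' right_mult_zero_mat[OF PD, of 1]
      by (simp, subst mult_four_block_mat[of _ 1 1 _ n _ n _ _ 1 _ n]) auto
  qed
  also have "\<dots> = B"
    unfolding P(3)[symmetric] using B
    by (intro eq_matI) (auto simp: K_def B'_def Bi0 B0i)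
  finally have BR: "B = R * mat_diag (Suc n) ?g * transpose_mat R" by simp
  note assoc = assoc_mult_mat[of _ "Suc n" "Suc n" _ "Suc n" _ "Suc n"]
  have cancel: "Q * (Q * M) = M" if "M \<in> carrier_mat (Suc n) (Suc n)" for M
    using assoc[OF Q(1) Q(1) that] Q(3) that by simp
  have "A = Q * B * Q"
    unfolding B_def using A Q by (simp add: assoc cancel mult_carrier_mat[of _ _ "Suc n"])
  also have "\<dots> = (Q * R) * mat_diag (Suc n) ?g * transpose_mat (Q * R)"
    unfolding BR transpose_mult[OF Q(1) R] Q(2) using Q R
    by (simp add: assoc mult_carrier_mat[of _ _ "Suc n"])
  finally have "A = (Q * R) * mat_diag (Suc n) ?g * transpose_mat (Q * R)" .
  moreover have "transpose_mat (Q * R) * (Q * R) = 1\<^sub>m (Suc n)"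
    unfolding transpose_mult[OF Q(1) R] Q(2) using Q R RR
    by (simp add: assoc cancel mult_carrier_mat[of _ _ "Suc n"])
  ultimately show ?case using Q(1) R by (intro exI[of _ "Q * R"] exI[of _ ?g]) auto
qed

section \<open>Orthogonal diagonalization\<close>

definition orth :: "nat \<Rightarrow> real mat \<Rightarrow> bool" where
  "orth n P \<longleftrightarrow> P \<in> carrier_mat n n \<and> transpose_mat P * P = 1\<^sub>m n"

text \<open>The columns of \<open>P\<close> are eigenvectors and \<open>f\<close> lists the
  eigenvalues. Fixing \<open>P\<close> and changing \<open>f\<close> gives the functional calculus
  of a symmetric matrix, which is how the Hessians of the envelopes are expressed.\<close>

definition spectral_mat :: "nat \<Rightarrow> real mat \<Rightarrow> (nat \<Rightarrow> real) \<Rightarrow> real mat" where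
  "spectral_mat n P f = P * mat_diag n f * transpose_mat P"

lemma orth_carrier [simp]: "orth n P \<Longrightarrow> P \<in> carrier_mat n n"
  and orth_transpose_carrier [simp]: "orth n P \<Longrightarrow> transpose_mat P \<in> carrier_mat n n"
  by (auto simp: orth_def)

lemma orth_mult_vec_carrier [simp]:
  assumes "orth n P" "x \<in> carrier_vec n"
  shows "P *\<^sub>v x \<in> carrier_vec n" "transpose_mat P *\<^sub>v x \<in> carrier_vec n"
  using assms by (auto intro: mult_mat_vec_carrier[of _ n n])

lemma orth_mult_cancel:
  assumes "orth n P" "x \<in> carrier_vec n"
  shows "transpose_mat P *\<^sub>v (P *\<^sub>v x) = x" "P *\<^sub>v (transpose_mat P *\<^sub>v x) = x"
proof -
  have P: "P \<in> carrier_mat n n" "transpose_mat P * P = 1\<^sub>m n" using assms by (auto simp: orth_def)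
  have "P * transpose_mat P = 1\<^sub>m n"
    using mat_mult_left_right_inverse[of "transpose_mat P" n P] P by simp
  thus "transpose_mat P *\<^sub>v (P *\<^sub>v x) = x" "P *\<^sub>v (transpose_mat P *\<^sub>v x) = x"
    using P assms(2)
    by (simp_all flip: assoc_mult_mat_vec[of _ n n _ n])
qed

lemma orth_scalar_prod:
  assumes "orth n P" "x \<in> carrier_vec n" "y \<in> carrier_vec n"
  shows "(transpose_mat P *\<^sub>v x) \<bullet> (transpose_mat P *\<^sub>v y) = x \<bullet> y"
  using scalar_prod_mult_mat_vec[of P n n x "transpose_mat P *\<^sub>v y"] orth_mult_cancel(2)[OF assms(1,3)]
    orth_carrier[OF assms(1)] assms by simp

lemma spectral_mat_carrier [simp]: "orth n P \<Longrightarrow> spectral_mat n P f \<in> carrier_mat n n"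
  by (auto simp: spectral_mat_def intro!: mult_carrier_mat[of _ n n])

lemma spectral_mat_symmetric:
  assumes "orth n P"
  shows "transpose_mat (spectral_mat n P f) = spectral_mat n P f"
proof -
  note c = orth_carrier[OF assms] mat_diag_dim[of n f] orth_transpose_carrier[OF assms]
  have "transpose_mat (mat_diag n f) = mat_diag n f" by (rule eq_matI) (auto simp: mat_diag_def)
  thus ?thesis
    unfolding spectral_mat_def transpose_mult[OF mult_carrier_mat[OF c(1,2)] c(3)] transpose_mult[OF c(1,2)]
    by (simp add: assoc_mult_mat[OF c])
qed

lemma mat_diag_mult_vec:
  assumes "y \<in> carrier_vec n"
  shows "mat_diag n f *\<^sub>v y = vec n (\<lambda>j. f j * (y $ j :: 'a :: semiring_0))"
proof (rule eq_vecI)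
  fix i assume "i < dim_vec (vec n (\<lambda>j. f j * y $ j))"
  hence i: "i < n" by simp
  have "(mat_diag n f *\<^sub>v y) $ i = (\<Sum>j = 0..<n. (if i = j then f j else 0) * y $ j)"
    using i assms by (simp add: mat_diag_def scalar_prod_def)
  also have "\<dots> = (\<Sum>j = 0..<n. if i = j then f j * y $ j else 0)"
    by (intro sum.cong) auto
  finally have "(mat_diag n f *\<^sub>v y) $ i = (\<Sum>j = 0..<n. if i = j then f j * y $ j else 0)" .
  thus "(mat_diag n f *\<^sub>v y) $ i = vec n (\<lambda>j. f j * y $ j) $ i" using i by simp
qed (simp add: mat_diag_def)

lemma spectral_mat_mult_vec:
  assumes "orth n P" "x \<in> carrier_vec n"
  shows "spectral_mat n P f *\<^sub>v x = P *\<^sub>v vec n (\<lambda>j. f j * (transpose_mat P *\<^sub>v x) $ j)"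
proof -
  note c = orth_carrier[OF assms(1)] mat_diag_dim[of n f] orth_transpose_carrier[OF assms(1)]
  note y = orth_mult_vec_carrier(2)[OF assms]
  show ?thesis
    unfolding spectral_mat_def assoc_mult_mat_vec[OF mult_carrier_mat[OF c(1,2)] c(3) assms(2)]
      assoc_mult_mat_vec[OF c(1,2) y] mat_diag_mult_vec[OF y] ..
qed

lemma scalar_prod_self_sum:
  "y \<in> carrier_vec n \<Longrightarrow> y \<bullet> y = (\<Sum>i<n. (y $ i :: real)\<^sup>2)"
  by (simp add: scalar_prod_def power2_eq_square atLeast0LessThan)

text \<open>The form is diagonal in the coordinates \<open>transpose_mat P *\<^sub>v x\<close>, so
  two matrices with the same \<open>P\<close> can be compared eigenvalue by eigenvalue.\<close>

lemma spectral_mat_quadratic_form: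
  assumes "orth n P" "x \<in> carrier_vec n"
  shows "x \<bullet> (spectral_mat n P f *\<^sub>v x) = (\<Sum>j<n. f j * ((transpose_mat P *\<^sub>v x) $ j)\<^sup>2)"
proof -
  let ?y = "transpose_mat P *\<^sub>v x"
  have "x \<bullet> (spectral_mat n P f *\<^sub>v x) = ?y \<bullet> vec n (\<lambda>j. f j * ?y $ j)"
    unfolding spectral_mat_mult_vec[OF assms]
    using scalar_prod_mult_mat_vec[of P n n x] assms by simp
  also have "\<dots> = (\<Sum>j<n. f j * (?y $ j)\<^sup>2)"
    by (auto simp: scalar_prod_def power2_eq_square atLeast0LessThan intro!: sum.cong)
  finally show ?thesis .
qed

lemma psd_spectral_mat:
  assumes "orth n P" "\<And>j. j < n \<Longrightarrow> 0 \<le> f j"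
  shows "psd n (spectral_mat n P f)"
  using assms unfolding psd_def
  by (auto simp: spectral_mat_symmetric spectral_mat_quadratic_form intro!: sum_nonneg)

lemma spectral_mat_eigenvector:
  assumes "orth n P" "j < n"
  shows "spectral_mat n P f *\<^sub>v (P *\<^sub>v unit_vec n j) = f j \<cdot>\<^sub>v (P *\<^sub>v unit_vec n j)"
    and "(P *\<^sub>v unit_vec n j) \<bullet> (P *\<^sub>v unit_vec n j) = 1"
proof -
  let ?e = "unit_vec n j :: real vec"
  have e: "vec n (\<lambda>i. f i * ?e $ i) = f j \<cdot>\<^sub>v ?e" using assms(2) by (intro eq_vecI) auto
  have c: "P *\<^sub>v ?e \<in> carrier_vec n" using assms by simp
  show "spectral_mat n P f *\<^sub>v (P *\<^sub>v ?e) = f j \<cdot>\<^sub>v (P *\<^sub>v ?e)"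
    unfolding spectral_mat_mult_vec[OF assms(1) c] orth_mult_cancel(1)[OF assms(1) unit_vec_carrier] e
    by (rule mult_mat_vec[OF orth_carrier[OF assms(1)]]) simp
  show "(P *\<^sub>v ?e) \<bullet> (P *\<^sub>v ?e) = 1"
    using orth_scalar_prod[OF assms(1), of "P *\<^sub>v ?e" "P *\<^sub>v ?e"] assms
      orth_mult_cancel(1)[OF assms(1), of ?e] by simp
qed

text \<open>In eigencoordinates \<open>y\<close> the eigenvalue equation reads
  \<open>f j * y $ j = k * y $ j\<close>, and some coordinate of an eigenvector is nonzero.
  Conversely, the columns of \<open>P\<close> are eigenvectors.\<close>

lemma spectrum_spectral_mat:
  assumes P: "orth n P"
  shows "spectrum (spectral_mat n P f) = f ` {..<n}"
proof (intro equalityI subsetI)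
  fix k assume "k \<in> spectrum (spectral_mat n P f)"
  then obtain x where x: "x \<in> carrier_vec n" "x \<noteq> 0\<^sub>v n" "spectral_mat n P f *\<^sub>v x = k \<cdot>\<^sub>v x"
    using spectral_mat_carrier[OF P, of f]
    by (auto simp: spectrum_def eigenvalue_def eigenvector_def)
  let ?y = "transpose_mat P *\<^sub>v x"
  have y: "?y \<in> carrier_vec n" using P x by simp
  have "vec n (\<lambda>j. f j * ?y $ j) = transpose_mat P *\<^sub>v (spectral_mat n P f *\<^sub>v x)"
    unfolding spectral_mat_mult_vec[OF P x(1)] using orth_mult_cancel(1)[OF P] by simp
  also have "\<dots> = k \<cdot>\<^sub>v ?y" unfolding x(3) using mult_mat_vec[of "transpose_mat P" n n x k] P x by simp
  finally have eq: "vec n (\<lambda>j. f j * ?y $ j) = k \<cdot>\<^sub>v ?y" .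
  have "?y \<noteq> 0\<^sub>v n"
    using orth_scalar_prod[OF P x(1) x(1)] scalar_prod_self_pos[OF x(1,2)] by auto
  then obtain j where j: "j < n" "?y $ j \<noteq> 0"
    using y by (metis eq_vecI carrier_vecD index_zero_vec)
  from arg_cong[OF eq, of "\<lambda>v. v $ j"] j y have "f j * ?y $ j = k * ?y $ j"
    using orth_carrier[OF P] by (simp del: index_mult_mat_vec)
  thus "k \<in> f ` {..<n}" using j by auto
next
  fix k assume "k \<in> f ` {..<n}"
  then obtain j where j: "j < n" "k = f j" by auto
  let ?v = "P *\<^sub>v unit_vec n j"
  have v: "?v \<in> carrier_vec n" using P by simp
  have "?v \<noteq> 0\<^sub>v n" using spectral_mat_eigenvector(2)[OF P j(1)] v by auto
  with v spectral_mat_eigenvector(1)[OF P j(1), of f] spectral_mat_carrier[OF P, of f]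
  show "k \<in> spectrum (spectral_mat n P f)" unfolding j(2)
    by (auto simp: spectrum_def eigenvalue_def eigenvector_def)
qed

text \<open>The eigenvalues are the values of the form at the unit eigenvectors, hence
  nonnegative.\<close>

lemma psd_spectral_decomposition:
  assumes "psd n A"
  obtains P f where "orth n P" "A = spectral_mat n P f" "\<And>j. j < n \<Longrightarrow> 0 \<le> f j"
proof -
  obtain P f where P: "orth n P" and A: "A = spectral_mat n P f"
    using spectral_theorem_real_symmetric[of A n] assms
    by (auto simp: psd_def orth_def spectral_mat_def)
  have "0 \<le> f j" if "j < n" for j
  proof -
    let ?v = "P *\<^sub>v unit_vec n j"
    have v: "?v \<in> carrier_vec n" using P by simp
    hence "0 \<le> ?v \<bullet> (A *\<^sub>v ?v)" using assms unfolding psd_def by blast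
    thus ?thesis using v by (simp add: A spectral_mat_eigenvector[OF P that])
  qed
  with P A show thesis by (rule that)
qed

lemma spectral_mat_eq_0:
  assumes "orth n P" "\<And>j. j < n \<Longrightarrow> f j = 0"
  shows "spectral_mat n P f = 0\<^sub>m n n"
proof -
  have "mat_diag n f = 0\<^sub>m n n" using assms(2) by (intro eq_matI) (auto simp: mat_diag_def)
  thus ?thesis
    using right_mult_zero_mat[OF orth_carrier[OF assms(1)], of n]
      left_mult_zero_mat[OF orth_transpose_carrier[OF assms(1)], of n] by (simp add: spectral_mat_def)
qed

section \<open>Extreme eigenvalues and Rayleigh quotients\<close>

lemma lambda_max_spectral_mat:
  assumes "orth n P" "0 < n"
  obtains j where "j < n" "lambda_max (spectral_mat n P f) = f j" "\<And>i. i < n \<Longrightarrow> f i \<le> f j"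
proof -
  have "Max (f ` {..<n}) \<in> f ` {..<n}" using assms(2) by (intro Max_in) auto
  then obtain j where "j < n" "Max (f ` {..<n}) = f j" by auto
  moreover have "f i \<le> Max (f ` {..<n})" if "i < n" for i using that by simp
  ultimately show thesis
    using that by (auto simp: lambda_max_def spectrum_spectral_mat[OF assms(1)])
qed

lemma lambda_min_pos_spectral_mat:
  assumes "orth n P" "\<And>j. j < n \<Longrightarrow> 0 \<le> f j" "spectral_mat n P f \<noteq> 0\<^sub>m n n"
  obtains j where "j < n" "lambda_min_pos (spectral_mat n P f) = f j" "0 < f j"
    "\<And>i. i < n \<Longrightarrow> f i = 0 \<or> f j \<le> f i"
proof -
  have "f ` {..<n} - {0} \<noteq> {}" using spectral_mat_eq_0[OF assms(1), of f] assms(3) by auto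
  hence "Min (f ` {..<n} - {0}) \<in> f ` {..<n} - {0}" by (intro Min_in) auto
  then obtain j where "j < n" "Min (f ` {..<n} - {0}) = f j" "f j \<noteq> 0" by auto
  moreover have "f i = 0 \<or> Min (f ` {..<n} - {0}) \<le> f i" if "i < n" for i
    using that by (cases "f i = 0") auto
  ultimately show thesis
    using that assms(2) by (auto simp: lambda_min_pos_def spectrum_spectral_mat[OF assms(1)] less_le)
qed

lemma rayleigh_le_lambda_max:
  assumes "psd n A" "x \<in> carrier_vec n" "0 < n"
  shows "x \<bullet> (A *\<^sub>v x) \<le> lambda_max A * (x \<bullet> x)"
proof -
  obtain P f where P: "orth n P" and A: "A = spectral_mat n P f"
    using psd_spectral_decomposition[OF assms(1)] by metis
  obtain j where j: "lambda_max A = f j" "\<And>i. i < n \<Longrightarrow> f i \<le> f j"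
    using lambda_max_spectral_mat[OF P assms(3), of f] A by metis
  let ?y = "transpose_mat P *\<^sub>v x"
  have y: "?y \<in> carrier_vec n" using P assms by simp
  have "x \<bullet> (A *\<^sub>v x) \<le> (\<Sum>i<n. f j * (?y $ i)\<^sup>2)"
    unfolding A spectral_mat_quadratic_form[OF P assms(2)] using j(2)
    by (intro sum_mono mult_right_mono) auto
  also have "\<dots> = f j * (?y \<bullet> ?y)"
    by (simp add: scalar_prod_self_sum[OF y] sum_distrib_left)
  also have "\<dots> = lambda_max A * (x \<bullet> x)" using orth_scalar_prod[OF P assms(2,2)] j by simp
  finally show ?thesis .
qed

lemma lambda_max_eigenvector:
  assumes "psd n A" "0 < n"
  obtains v where "v \<in> carrier_vec n" "v \<bullet> v = 1" "A *\<^sub>v v = lambda_max A \<cdot>\<^sub>v v"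
proof -
  obtain P f where P: "orth n P" and A: "A = spectral_mat n P f"
    using psd_spectral_decomposition[OF assms(1)] by metis
  obtain j where j: "lambda_max A = f j" "j < n"
    using lambda_max_spectral_mat[OF P assms(2), of f] A by metis
  show thesis
    by (rule that[of "P *\<^sub>v unit_vec n j"]) (use P spectral_mat_eigenvector[OF P j(2)] in \<open>simp_all add: A flip: j(1)\<close>)
qed

text \<open>A vector orthogonal to the kernel has no component along eigenvectors of eigenvalue 0,
  so every eigenvalue that contributes to its form is at least
  \<open>lambda_min_pos A\<close>.\<close>

lemma lambda_min_pos_le_rayleigh:
  assumes "psd n A" "A \<noteq> 0\<^sub>m n n" "x \<in> carrier_vec n"
    and ker: "\<And>u. u \<in> carrier_vec n \<Longrightarrow> A *\<^sub>v u = 0\<^sub>v n \<Longrightarrow> u \<bullet> x = 0"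
  shows "lambda_min_pos A * (x \<bullet> x) \<le> x \<bullet> (A *\<^sub>v x)"
proof -
  obtain P f where P: "orth n P" and A: "A = spectral_mat n P f" and f: "\<And>j. j < n \<Longrightarrow> 0 \<le> f j"
    using psd_spectral_decomposition[OF assms(1)] by metis
  obtain j where j: "lambda_min_pos A = f j" "\<And>i. i < n \<Longrightarrow> f i = 0 \<or> f j \<le> f i"
    using lambda_min_pos_spectral_mat[OF P f assms(2)[unfolded A]] A by metis
  let ?y = "transpose_mat P *\<^sub>v x"
  have y: "?y \<in> carrier_vec n" using P assms by simp
  have le: "f j * (?y $ i)\<^sup>2 \<le> f i * (?y $ i)\<^sup>2" if i: "i < n" for i
  proof (cases "f i = 0")
    case True
    \<comment> \<open>This column lies in the kernel, and its scalar product with \<open>x\<close>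
      is the coordinate \<open>?y $ i\<close>, which therefore vanishes.\<close>
    let ?u = "P *\<^sub>v unit_vec n i"
    have u: "?u \<in> carrier_vec n" using P by simp
    have "A *\<^sub>v ?u = 0\<^sub>v n"
      unfolding A spectral_mat_eigenvector(1)[OF P i] True
      using carrier_vecD[OF u] by (intro eq_vecI) (auto simp del: index_mult_mat_vec dim_mult_mat_vec)
    hence "?u \<bullet> x = 0" using ker u by simp
    moreover have "?u \<bullet> x = ?y $ i"
      using orth_scalar_prod[OF P u assms(3)] orth_mult_cancel(1)[OF P, of "unit_vec n i"] y i by simp
    ultimately show ?thesis by simp
  next
    case False
    thus ?thesis using j(2)[OF i] by (intro mult_right_mono) auto
  qed
  have "lambda_min_pos A * (x \<bullet> x) = f j * (?y \<bullet> ?y)"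
    using orth_scalar_prod[OF P assms(3,3)] j by simp
  also have "\<dots> = (\<Sum>i<n. f j * (?y $ i)\<^sup>2)"
    by (simp add: scalar_prod_self_sum[OF y] sum_distrib_left)
  also have "\<dots> \<le> x \<bullet> (A *\<^sub>v x)"
    unfolding A spectral_mat_quadratic_form[OF P assms(3)] using le by (intro sum_mono) auto
  finally show ?thesis .
qed

lemma lambda_min_pos_eigenvector:
  assumes "psd n A" "A \<noteq> 0\<^sub>m n n"
  obtains v where "v \<in> carrier_vec n" "v \<bullet> v = 1" "A *\<^sub>v v = lambda_min_pos A \<cdot>\<^sub>v v"
    "0 < lambda_min_pos A"
proof -
  obtain P f where P: "orth n P" and A: "A = spectral_mat n P f" and f: "\<And>j. j < n \<Longrightarrow> 0 \<le> f j"
    using psd_spectral_decomposition[OF assms(1)] by metis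
  obtain j where j: "lambda_min_pos A = f j" "0 < f j" "j < n"
    using lambda_min_pos_spectral_mat[OF P f assms(2)[unfolded A]] A by metis
  show thesis
    by (rule that[of "P *\<^sub>v unit_vec n j"]) (use P j(2) spectral_mat_eigenvector[OF P j(3)] in \<open>simp_all add: A flip: j(1)\<close>)
qed

text \<open>Evaluate the comparison at a unit eigenvector of \<open>A\<close> for its largest
  eigenvalue and bound the form of \<open>B\<close> there by its Rayleigh quotient.\<close>

lemma lambda_max_mono:
  assumes "psd n A" "psd n B" "0 < n"
    and le: "\<And>x. x \<in> carrier_vec n \<Longrightarrow> x \<bullet> (A *\<^sub>v x) \<le> c * (x \<bullet> (B *\<^sub>v x))" and "0 \<le> c"
  shows "lambda_max A \<le> c * lambda_max B"
proof -
  obtain v where v: "v \<in> carrier_vec n" "v \<bullet> v = 1" "A *\<^sub>v v = lambda_max A \<cdot>\<^sub>v v"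
    using lambda_max_eigenvector[OF assms(1,3)] by metis
  have "lambda_max A = v \<bullet> (A *\<^sub>v v)" using v by simp
  also have "\<dots> \<le> c * (v \<bullet> (B *\<^sub>v v))" by (rule le[OF v(1)])
  also have "\<dots> \<le> c * (lambda_max B * (v \<bullet> v))"
    using rayleigh_le_lambda_max[OF assms(2) v(1) assms(3)] \<open>0 \<le> c\<close> by (rule mult_left_mono)
  finally show ?thesis using v by simp
qed

text \<open>In eigencoordinates \<open>y\<close> the form is a sum of nonnegative terms
  \<open>f j * (y $ j)\<^sup>2\<close>; if it vanishes, so does each
  \<open>f j * y $ j\<close>.\<close>

lemma psd_quadratic_form_eq_0:
  assumes "psd n A" "x \<in> carrier_vec n" "x \<bullet> (A *\<^sub>v x) = 0"
  shows "A *\<^sub>v x = 0\<^sub>v n"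
proof -
  obtain P f where P: "orth n P" and A: "A = spectral_mat n P f" and f: "\<And>j. j < n \<Longrightarrow> 0 \<le> f j"
    using psd_spectral_decomposition[OF assms(1)] by metis
  let ?y = "transpose_mat P *\<^sub>v x"
  have "\<forall>j\<in>{..<n}. f j * (?y $ j)\<^sup>2 = 0"
    using assms(3) f unfolding A spectral_mat_quadratic_form[OF P assms(2)]
    by (subst (asm) sum_nonneg_eq_0_iff) auto
  hence "vec n (\<lambda>j. f j * ?y $ j) = 0\<^sub>v n" by (intro eq_vecI) auto
  thus ?thesis unfolding A spectral_mat_mult_vec[OF P assms(2)]
    using mult_mat_vec[OF orth_carrier[OF P], of "0\<^sub>v n" 0] orth_carrier[OF P]
    by (intro eq_vecI) auto
qed

text \<open>The second comparison makes the kernels agree, so that an eigenvector of \<open>B\<close> for its smallest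
  nonzero eigenvalue is orthogonal to the kernel of \<open>A\<close>.\<close>

lemma lambda_min_pos_mono:
  assumes "psd n A" "psd n B" "A \<noteq> 0\<^sub>m n n" "B \<noteq> 0\<^sub>m n n"
    and le: "\<And>x. x \<in> carrier_vec n \<Longrightarrow> x \<bullet> (A *\<^sub>v x) \<le> c * (x \<bullet> (B *\<^sub>v x))"
    and ge: "\<And>x. x \<in> carrier_vec n \<Longrightarrow> x \<bullet> (B *\<^sub>v x) \<le> c' * (x \<bullet> (A *\<^sub>v x))"
  shows "lambda_min_pos A \<le> c * lambda_min_pos B"
proof -
  obtain v where v: "v \<in> carrier_vec n" "v \<bullet> v = 1" "B *\<^sub>v v = lambda_min_pos B \<cdot>\<^sub>v v"
      "0 < lambda_min_pos B"
    using lambda_min_pos_eigenvector[OF assms(2,4)] by metis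
  have B: "B \<in> carrier_mat n n" "transpose_mat B = B"
    and nonneg: "\<And>x. x \<in> carrier_vec n \<Longrightarrow> 0 \<le> x \<bullet> (B *\<^sub>v x)" using assms(2) by (auto simp: psd_def)
  \<comment> \<open>By \<open>ge\<close> the form of \<open>B\<close> vanishes at \<open>u\<close>,
    so \<open>u\<close> is in the kernel of \<open>B\<close>; symmetry of \<open>B\<close> and the
    nonzero eigenvalue of \<open>v\<close> then give orthogonality.\<close>
  have "u \<bullet> v = 0" if u: "u \<in> carrier_vec n" "A *\<^sub>v u = 0\<^sub>v n" for u
  proof -
    have "u \<bullet> (B *\<^sub>v u) = 0" using ge[OF u(1)] nonneg[OF u(1)] u by simp
    hence "B *\<^sub>v u = 0\<^sub>v n" by (rule psd_quadratic_form_eq_0[OF assms(2) u(1)])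
    hence "u \<bullet> (B *\<^sub>v v) = 0" using scalar_prod_mult_mat_vec[OF B(1) u(1) v(1)] B(2) v by simp
    thus ?thesis using v u by simp
  qed
  from lambda_min_pos_le_rayleigh[OF assms(1,3) v(1) this]
  have "lambda_min_pos A \<le> v \<bullet> (A *\<^sub>v v)" using v by simp
  also have "\<dots> \<le> c * (v \<bullet> (B *\<^sub>v v))" by (rule le[OF v(1)])
  finally show ?thesis using v by simp
qed

section \<open>Moreau envelopes of quadratics\<close>

text \<open>Completing the square in \<open>y\<close>. The square vanishes at the proximal point,
  and the remainder is the one-dimensional envelope as a function of \<open>\<xi>\<close>, with
  curvature \<open>f / (1 + \<gamma> * f)\<close>.\<close>

lemma moreau_scalar_identity:
  fixes f \<gamma> \<beta> \<xi> y :: real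
  assumes "0 \<le> f" "0 < \<gamma>"
  shows "1 / 2 * (f * y\<^sup>2) - \<beta> * y + 1 / (2 * \<gamma>) * (y - \<xi>)\<^sup>2
    = (1 + \<gamma> * f) / (2 * \<gamma>) * (y - (\<xi> + \<gamma> * \<beta>) / (1 + \<gamma> * f))\<^sup>2
      + (1 / 2 * (f / (1 + \<gamma> * f) * \<xi>\<^sup>2) - \<beta> / (1 + \<gamma> * f) * \<xi> - \<gamma> * \<beta>\<^sup>2 / (2 * (1 + \<gamma> * f)))"
proof -
  \<comment> \<open>In these terms the left side is
    \<open>(D * y\<^sup>2 - 2 * u * y + \<xi>\<^sup>2) / (2 * \<gamma>)\<close>, a parabola with
    vertex \<open>u / D\<close>.\<close>
  define D where "D = 1 + \<gamma> * f"
  define u where "u = \<xi> + \<gamma> * \<beta>"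
  have D: "0 < D" using assms by (simp add: D_def add_pos_nonneg)
  have "1 / 2 * (f * y\<^sup>2) - \<beta> * y + 1 / (2 * \<gamma>) * (y - \<xi>)\<^sup>2
      = D * y\<^sup>2 / (2 * \<gamma>) - y * u / \<gamma> + \<xi>\<^sup>2 / (2 * \<gamma>)"
    using assms unfolding D_def u_def by (simp add: field_simps power2_eq_square)
  moreover have "D / (2 * \<gamma>) * (y - u / D)\<^sup>2 = D * y\<^sup>2 / (2 * \<gamma>) - y * u / \<gamma> + u\<^sup>2 / (2 * \<gamma> * D)"
    using assms D by (simp add: field_simps power2_eq_square)
  moreover have "\<xi>\<^sup>2 / (2 * \<gamma>) = u\<^sup>2 / (2 * \<gamma> * D)
      + (1 / 2 * (f / D * \<xi>\<^sup>2) - \<beta> / D * \<xi> - \<gamma> * \<beta>\<^sup>2 / (2 * D))"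
  proof -
    have "u\<^sup>2 + (\<gamma> * f * \<xi>\<^sup>2 - 2 * \<gamma> * \<beta> * \<xi> - \<gamma>\<^sup>2 * \<beta>\<^sup>2) = D * \<xi>\<^sup>2"
      by (simp add: u_def D_def power2_eq_square algebra_simps)
    hence "(u\<^sup>2 + (\<gamma> * f * \<xi>\<^sup>2 - 2 * \<gamma> * \<beta> * \<xi> - \<gamma>\<^sup>2 * \<beta>\<^sup>2)) / (2 * \<gamma> * D) = \<xi>\<^sup>2 / (2 * \<gamma>)"
      using D by simp
    thus ?thesis using D assms(2)
      by (simp add: add_divide_distrib diff_divide_distrib power2_eq_square)
  qed
  ultimately show ?thesis unfolding D_def[symmetric] u_def[symmetric] by simp
qed

text \<open>An orthogonal change of coordinates preserves the penalty and decouples the minimization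
  into scalar problems. The linear term and the constant are left existential because the Hessian
  sees neither.\<close>

lemma moreau_quad_spectral_mat:
  assumes P: "orth n P" and f: "\<And>j. j < n \<Longrightarrow> 0 \<le> f j" and b: "b \<in> carrier_vec n" and \<gamma>: "0 < \<gamma>"
  obtains w c where "w \<in> carrier_vec n"
    "\<And>x. x \<in> carrier_vec n \<Longrightarrow> moreau n \<gamma> (quad (spectral_mat n P f) b) x
      = quad (spectral_mat n P (\<lambda>j. f j / (1 + \<gamma> * f j))) w x + c"
proof
  let ?T = "transpose_mat P"
  let ?b = "?T *\<^sub>v b"
  \<comment> \<open>\<open>w\<close> and \<open>c\<close> collect the linear and the constant terms
    of the scalar identity over all coordinates.\<close>
  define w where "w = P *\<^sub>v vec n (\<lambda>j. ?b $ j / (1 + \<gamma> * f j))"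
  define c where "c = - (\<Sum>j<n. \<gamma> * (?b $ j)\<^sup>2 / (2 * (1 + \<gamma> * f j)))"
  show w: "w \<in> carrier_vec n" unfolding w_def using P by simp
  have T: "?T *\<^sub>v x \<in> carrier_vec n" if "x \<in> carrier_vec n" for x using P that by simp
  have prod: "x \<bullet> y = (\<Sum>j<n. (?T *\<^sub>v x) $ j * (?T *\<^sub>v y) $ j)"
    if "x \<in> carrier_vec n" "y \<in> carrier_vec n" for x y
    using orth_scalar_prod[OF P that] carrier_vecD[OF T[OF that(2)]]
    by (simp only: scalar_prod_def atLeast0LessThan)
  have Tw: "?T *\<^sub>v w = vec n (\<lambda>j. ?b $ j / (1 + \<gamma> * f j))"
    unfolding w_def by (rule orth_mult_cancel(1)[OF P]) simp
  fix x :: "real vec" assume x: "x \<in> carrier_vec n"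
  let ?x = "?T *\<^sub>v x"
  define h where "h z = quad (spectral_mat n P f) b z + 1 / (2 * \<gamma>) * ((z - x) \<bullet> (z - x))" for z
  define m where "m j = (?x $ j + \<gamma> * ?b $ j) / (1 + \<gamma> * f j)" for j
  let ?v = "quad (spectral_mat n P (\<lambda>j. f j / (1 + \<gamma> * f j))) w x + c"
  \<comment> \<open>The objective is a sum of nonnegative squares plus \<open>?v\<close>, which does
    not depend on \<open>z\<close>.\<close>
  have hz: "h z = (\<Sum>j<n. (1 + \<gamma> * f j) / (2 * \<gamma>) * ((?T *\<^sub>v z) $ j - m j)\<^sup>2) + ?v"
    if z: "z \<in> carrier_vec n" for z
  proof -
    let ?z = "?T *\<^sub>v z"
    have zx: "(?T *\<^sub>v (z - x)) $ j = ?z $ j - ?x $ j" if "j < n" for j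
    proof -
      have "?T *\<^sub>v (z - x) = ?z - ?x" using P x z by (intro mult_minus_distrib_mat_vec[of _ n n]) auto
      thus ?thesis using that carrier_vecD[OF T[OF x]] by (simp only: index_minus_vec)
    qed
    have "h z = (\<Sum>j<n. 1 / 2 * (f j * (?z $ j)\<^sup>2) - ?b $ j * ?z $ j + 1 / (2 * \<gamma>) * (?z $ j - ?x $ j)\<^sup>2)"
      unfolding h_def quad_def spectral_mat_quadratic_form[OF P z] prod[OF b z]
      using prod[of "z - x" "z - x"] x z zx
      by (simp add: sum.distrib sum_subtractf sum_distrib_left power2_eq_square del: index_mult_mat_vec)
    also have "\<dots> = (\<Sum>j<n. (1 + \<gamma> * f j) / (2 * \<gamma>) * (?z $ j - m j)\<^sup>2
      + (1 / 2 * (f j / (1 + \<gamma> * f j) * (?x $ j)\<^sup>2) - ?b $ j / (1 + \<gamma> * f j) * ?x $ j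
      - \<gamma> * (?b $ j)\<^sup>2 / (2 * (1 + \<gamma> * f j))))"
      unfolding m_def using f \<gamma> by (intro sum.cong refl moreau_scalar_identity) auto
    also have "\<dots> = (\<Sum>j<n. (1 + \<gamma> * f j) / (2 * \<gamma>) * (?z $ j - m j)\<^sup>2) + ?v"
      unfolding c_def quad_def spectral_mat_quadratic_form[OF P x] prod[OF w x] Tw
      by (simp add: sum.distrib sum_subtractf sum_distrib_left del: index_mult_mat_vec)
    finally show ?thesis .
  qed
  \<comment> \<open>The point with eigencoordinates \<open>m\<close> annihilates all squares, so the
    infimum \<open>?v\<close> is attained there.\<close>
  define z where "z = P *\<^sub>v vec n m"
  have z: "z \<in> carrier_vec n" using P by (simp add: z_def)
  have "?T *\<^sub>v z = vec n m" unfolding z_def by (rule orth_mult_cancel(1)[OF P]) simp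
  hence "h z = ?v" unfolding hz[OF z] by simp
  moreover have "?v \<le> h y" if "y \<in> carrier_vec n" for y
    unfolding hz[OF that] using f \<gamma> by (auto intro!: sum_nonneg)
  ultimately have "Inf (h ` carrier_vec n) = ?v"
    using z by (intro cInf_eq_minimum) (auto intro: rev_image_eqI)
  thus "moreau n \<gamma> (quad (spectral_mat n P f) b) x = ?v"
    by (simp add: moreau_def h_def[abs_def])
qed

section \<open>Gradients and Hessians of quadratics\<close>

lemma symmetric_index:
  "M \<in> carrier_mat n n \<Longrightarrow> transpose_mat M = M \<Longrightarrow> i < n \<Longrightarrow> j < n \<Longrightarrow> M $$ (j, i) = M $$ (i, j)"
  by (metis carrier_matD index_transpose_mat(1))

text \<open>The exact second-order expansion along a line, with the two cross terms merged by
  symmetry. For a unit vector \<open>e\<close> the coefficient of \<open>t\<close> is a partial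
  derivative.\<close>

lemma quad_line:
  assumes H: "H \<in> carrier_mat n n" "transpose_mat H = H"
    and w: "w \<in> carrier_vec n" and x: "x \<in> carrier_vec n" and e: "e \<in> carrier_vec n"
  shows "quad H w (x + t \<cdot>\<^sub>v e)
    = quad H w x + t * (e \<bullet> (H *\<^sub>v x) - w \<bullet> e) + t\<^sup>2 * (1 / 2 * (e \<bullet> (H *\<^sub>v e)))"
proof -
  have Hx: "H *\<^sub>v x \<in> carrier_vec n" and He: "H *\<^sub>v e \<in> carrier_vec n" using H x e by auto
  have sym: "x \<bullet> (H *\<^sub>v e) = e \<bullet> (H *\<^sub>v x)"
    using scalar_prod_mult_mat_vec[OF H(1) x e] H(2) comm_scalar_prod[OF Hx e] by simp
  have He': "H *\<^sub>v (x + t \<cdot>\<^sub>v e) = H *\<^sub>v x + t \<cdot>\<^sub>v (H *\<^sub>v e)"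
    using mult_add_distrib_mat_vec[OF H(1) x, of "t \<cdot>\<^sub>v e"] mult_mat_vec[OF H(1) e, of t] e by simp
  have q: "(x + t \<cdot>\<^sub>v e) \<bullet> (H *\<^sub>v x + t \<cdot>\<^sub>v (H *\<^sub>v e))
      = x \<bullet> (H *\<^sub>v x) + t * (e \<bullet> (H *\<^sub>v x)) + t * (x \<bullet> (H *\<^sub>v e)) + t * (t * (e \<bullet> (H *\<^sub>v e)))"
    using x e Hx He by (simp add: scalar_prod_add_distrib[of _ n] add_scalar_prod_distrib[of _ n] distrib_left)
  have l: "w \<bullet> (x + t \<cdot>\<^sub>v e) = w \<bullet> x + t * (w \<bullet> e)"
    using w x e by (simp add: scalar_prod_add_distrib[of _ n])
  show ?thesis unfolding quad_def He' q l sym by (simp add: algebra_simps power2_eq_square)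
qed

text \<open>Prescribing \<open>F\<close> on \<open>carrier_vec n\<close> is enough, since that set
  contains every line along which the partial derivatives are taken.\<close>

lemma grad_quad:
  assumes H: "H \<in> carrier_mat n n" "transpose_mat H = H" and w: "w \<in> carrier_vec n"
    and F: "\<And>x. x \<in> carrier_vec n \<Longrightarrow> F x = quad H w x + c" and x: "x \<in> carrier_vec n"
  shows "grad n F x = H *\<^sub>v x - w"
proof (rule eq_vecI)
  fix j assume "j < dim_vec (H *\<^sub>v x - w)"
  hence j: "j < n" using w by simp
  let ?e = "unit_vec n j :: real vec"
  let ?q = "\<lambda>t. quad H w x + t * (?e \<bullet> (H *\<^sub>v x) - w \<bullet> ?e) + t\<^sup>2 * (1 / 2 * (?e \<bullet> (H *\<^sub>v ?e))) + c"
  have "(\<lambda>t. F (x + t \<cdot>\<^sub>v ?e)) = ?q" using F x quad_line[OF H w x, of ?e] by (intro ext) simp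
  moreover have "(?q has_real_derivative ?e \<bullet> (H *\<^sub>v x) - w \<bullet> ?e) (at 0)"
    by (auto intro!: derivative_eq_intros)
  ultimately have "grad n F x $ j = ?e \<bullet> (H *\<^sub>v x) - w \<bullet> ?e"
    using j DERIV_imp_deriv by (simp add: grad_def)
  thus "grad n F x $ j = (H *\<^sub>v x - w) $ j"
    using j H x w scalar_prod_left_unit[of "H *\<^sub>v x" n j] by (simp del: index_mult_mat_vec)
qed (use w in \<open>simp add: grad_def\<close>)

lemma hessian_quad:
  assumes H: "H \<in> carrier_mat n n" "transpose_mat H = H" and w: "w \<in> carrier_vec n"
    and F: "\<And>x. x \<in> carrier_vec n \<Longrightarrow> F x = quad H w x + c" and x: "x \<in> carrier_vec n"
  shows "hessian n F x = H"
proof (rule eq_matI)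
  fix i j assume "i < dim_row H" "j < dim_col H"
  hence i: "i < n" and j: "j < n" using H by auto
  let ?e = "unit_vec n i :: real vec"
  \<comment> \<open>The gradient is affine. Its component \<open>j\<close> has slope
    \<open>H $$ (j, i)\<close> in direction \<open>i\<close>, which symmetry turns into the entry
    wanted.\<close>
  have "grad n F (x + t \<cdot>\<^sub>v ?e) $ j = (H *\<^sub>v x - w) $ j + t * (H $$ (i, j))" for t
  proof -
    have "grad n F (x + t \<cdot>\<^sub>v ?e) = H *\<^sub>v x + t \<cdot>\<^sub>v (H *\<^sub>v ?e) - w"
      using x by (simp add: grad_quad[OF H w F] mult_add_distrib_mat_vec[OF H(1)] mult_mat_vec[OF H(1)])
    moreover have "(H *\<^sub>v ?e) $ j = H $$ (i, j)"
      using i j H symmetric_index[OF H i j] by simp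
    ultimately show ?thesis using j H w x by (simp del: index_mult_mat_vec)
  qed
  moreover have "((\<lambda>t. (H *\<^sub>v x - w) $ j + t * (H $$ (i, j))) has_real_derivative H $$ (i, j)) (at 0)"
    by (auto intro!: derivative_eq_intros)
  ultimately show "hessian n F x $$ (i, j) = H $$ (i, j)"
    using i j DERIV_imp_deriv by (simp add: hessian_def)
qed (use H in \<open>auto simp: hessian_def\<close>)

section \<open>Averaged matrices and the Hessian of the averaged envelope\<close>

lemma avg_mat_carrier [simp]: "avg_mat d n A \<in> carrier_mat d d"
  by (simp add: avg_mat_def)

lemma avg_mat_symmetric:
  assumes "\<And>i. i \<in> {1..n} \<Longrightarrow> A i \<in> carrier_mat d d \<and> transpose_mat (A i) = A i"
  shows "transpose_mat (avg_mat d n A) = avg_mat d n A"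
proof (rule eq_matI)
  fix j k assume "j < dim_row (avg_mat d n A)" "k < dim_col (avg_mat d n A)"
  hence j: "j < d" and k: "k < d" by (auto simp: avg_mat_def)
  have "A i $$ (k, j) = A i $$ (j, k)" if "i \<in> {1..n}" for i
    using symmetric_index[OF _ _ j k] assms[OF that] by blast
  thus "transpose_mat (avg_mat d n A) $$ (j, k) = avg_mat d n A $$ (j, k)"
    using j k by (simp add: avg_mat_def)
qed (auto simp: avg_mat_def)

text \<open>The average is defined entrywise, so the form is expanded into a double sum over entries
  and the sum over \<open>i\<close> is moved outside.\<close>

lemma avg_mat_quadratic_form:
  assumes A: "\<And>i. i \<in> {1..n} \<Longrightarrow> A i \<in> carrier_mat d d" and x: "x \<in> carrier_vec d"
  shows "x \<bullet> (avg_mat d n A *\<^sub>v x) = 1 / real n * (\<Sum>i = 1..n. x \<bullet> (A i *\<^sub>v x))"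
proof -
  have form: "x \<bullet> (M *\<^sub>v x) = (\<Sum>j<d. \<Sum>k<d. x $ j * (M $$ (j, k) * x $ k))"
    if "M \<in> carrier_mat d d" for M :: "real mat"
    using that x by (simp add: scalar_prod_def atLeast0LessThan sum_distrib_left)
  have "x \<bullet> (avg_mat d n A *\<^sub>v x)
      = (\<Sum>j<d. \<Sum>k<d. \<Sum>i = 1..n. 1 / real n * (x $ j * (A i $$ (j, k) * x $ k)))"
    unfolding form[OF avg_mat_carrier]
    by (intro sum.cong refl) (simp add: avg_mat_def sum_distrib_left sum_distrib_right sum_divide_distrib)
  also have "\<dots> = (\<Sum>j<d. \<Sum>i = 1..n. \<Sum>k<d. 1 / real n * (x $ j * (A i $$ (j, k) * x $ k)))"
    by (intro sum.cong refl sum.swap)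
  also have "\<dots> = (\<Sum>i = 1..n. \<Sum>j<d. \<Sum>k<d. 1 / real n * (x $ j * (A i $$ (j, k) * x $ k)))"
    by (rule sum.swap)
  also have "\<dots> = (\<Sum>i = 1..n. 1 / real n * (x \<bullet> (A i *\<^sub>v x)))"
    using A by (intro sum.cong refl) (simp add: form sum_distrib_left)
  finally show ?thesis by (simp add: sum_distrib_left)
qed

lemma psd_avg_mat:
  assumes "\<And>i. i \<in> {1..n} \<Longrightarrow> psd d (A i)"
  shows "psd d (avg_mat d n A)"
proof -
  have A: "A i \<in> carrier_mat d d" "transpose_mat (A i) = A i"
    "\<And>x. x \<in> carrier_vec d \<Longrightarrow> 0 \<le> x \<bullet> (A i *\<^sub>v x)" if "i \<in> {1..n}" for i
    using assms[OF that] by (auto simp: psd_def)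
  have "0 \<le> x \<bullet> (avg_mat d n A *\<^sub>v x)" if "x \<in> carrier_vec d" for x
    by (subst avg_mat_quadratic_form) (use A that in \<open>auto intro!: divide_nonneg_nonneg sum_nonneg\<close>)
  thus ?thesis using A(1,2) by (auto simp: psd_def intro!: avg_mat_symmetric)
qed

lemma avg_quad:
  assumes A: "\<And>i. i \<in> {1..n} \<Longrightarrow> A i \<in> carrier_mat d d"
    and w: "\<And>i. i \<in> {1..n} \<Longrightarrow> w i \<in> carrier_vec d" and x: "x \<in> carrier_vec d"
  shows "1 / real n * (\<Sum>i = 1..n. quad (A i) (w i) x)
    = quad (avg_mat d n A) (vec d (\<lambda>j. 1 / real n * (\<Sum>i = 1..n. w i $ j))) x"
proof -
  have "vec d (\<lambda>j. 1 / real n * (\<Sum>i = 1..n. w i $ j)) \<bullet> x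
      = (\<Sum>j<d. \<Sum>i = 1..n. 1 / real n * (w i $ j * x $ j))"
    using x by (simp add: scalar_prod_def atLeast0LessThan sum_distrib_left sum_distrib_right sum_divide_distrib)
  also have "\<dots> = (\<Sum>i = 1..n. \<Sum>j<d. 1 / real n * (w i $ j * x $ j))" by (rule sum.swap)
  also have "\<dots> = (\<Sum>i = 1..n. 1 / real n * (w i \<bullet> x))"
    using x by (simp add: scalar_prod_def atLeast0LessThan sum_distrib_left)
  finally have w: "vec d (\<lambda>j. 1 / real n * (\<Sum>i = 1..n. w i $ j)) \<bullet> x = 1 / real n * (\<Sum>i = 1..n. w i \<bullet> x)"
    by (simp only: sum_distrib_left)
  have q: "x \<bullet> (avg_mat d n A *\<^sub>v x) = 1 / real n * (\<Sum>i = 1..n. x \<bullet> (A i *\<^sub>v x))"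
    by (rule avg_mat_quadratic_form) (use A x in auto)
  show ?thesis
    unfolding quad_def q w sum_subtractf right_diff_distrib
    by (simp add: sum_distrib_left mult.commute)
qed

text \<open>For \<open>\<gamma> > 0\<close> the number \<open>t / (1 + \<gamma> * t)\<close> equals
  \<open>(1 - 1 / (1 + \<gamma> * t)) / \<gamma>\<close>, the eigenvalue in the usual resolvent
  formula for the Hessian. Written this way the formula also covers \<open>\<gamma> = 0\<close>,
  where it returns the average of the \<open>A i\<close>.\<close>

lemma curvature_spectral_mat:
  assumes P: "\<And>i. i \<in> {1..n} \<Longrightarrow> orth d (P i)"
    and f: "\<And>i j. i \<in> {1..n} \<Longrightarrow> j < d \<Longrightarrow> 0 \<le> f i j"
    and A: "\<And>i. i \<in> {1..n} \<Longrightarrow> A i = spectral_mat d (P i) (f i)"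
    and b: "\<And>i. i \<in> {1..n} \<Longrightarrow> b i \<in> carrier_vec d" and \<gamma>: "0 \<le> \<gamma>"
  shows "curvature d n A b \<gamma> = avg_mat d n (\<lambda>i. spectral_mat d (P i) (\<lambda>j. f i j / (1 + \<gamma> * f i j)))"
    (is "_ = avg_mat d n ?D")
proof (cases "\<gamma> = 0")
  case True
  thus ?thesis using A by (auto simp: curvature_def avg_mat_def intro!: cong_mat)
next
  case False
  hence g: "0 < \<gamma>" using \<gamma> by simp
  have "\<exists>w c. w \<in> carrier_vec d \<and> (\<forall>x \<in> carrier_vec d. moreau d \<gamma> (quad (A i) (b i)) x = quad (?D i) w x + c)"
    if i: "i \<in> {1..n}" for i
  proof -
    obtain w c where "w \<in> carrier_vec d" and "\<And>x. x \<in> carrier_vec d \<Longrightarrow>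
        moreau d \<gamma> (quad (spectral_mat d (P i) (f i)) (b i)) x = quad (?D i) w x + c"
      by (rule moreau_quad_spectral_mat[OF P[OF i] _ b[OF i] g, of "f i"]) (use f[OF i] in blast)+
    thus ?thesis unfolding A[OF i] by blast
  qed
  then obtain w c where w: "\<And>i. i \<in> {1..n} \<Longrightarrow> w i \<in> carrier_vec d"
    and m: "\<And>i x. i \<in> {1..n} \<Longrightarrow> x \<in> carrier_vec d \<Longrightarrow>
      moreau d \<gamma> (quad (A i) (b i)) x = quad (?D i) (w i) x + c i"
    by metis
  have D: "?D i \<in> carrier_mat d d" if "i \<in> {1..n}" for i using P[OF that] by simp
  have "avg_moreau d n A b \<gamma> x
      = quad (avg_mat d n ?D) (vec d (\<lambda>j. 1 / real n * (\<Sum>i = 1..n. w i $ j))) x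
        + 1 / real n * (\<Sum>i = 1..n. c i)" if x: "x \<in> carrier_vec d" for x
  proof -
    have "avg_moreau d n A b \<gamma> x = 1 / real n * (\<Sum>i = 1..n. quad (?D i) (w i) x + c i)"
      unfolding avg_moreau_def using m[OF _ x] by (metis (no_types, lifting) sum.cong)
    also have "\<dots> = 1 / real n * (\<Sum>i = 1..n. quad (?D i) (w i) x) + 1 / real n * (\<Sum>i = 1..n. c i)"
      by (simp only: sum.distrib distrib_left)
    also have "1 / real n * (\<Sum>i = 1..n. quad (?D i) (w i) x)
        = quad (avg_mat d n ?D) (vec d (\<lambda>j. 1 / real n * (\<Sum>i = 1..n. w i $ j))) x"
      by (rule avg_quad) (use D w x in auto)
    finally show ?thesis .
  qed
  moreover have "transpose_mat (avg_mat d n ?D) = avg_mat d n ?D"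
    using P spectral_mat_symmetric by (intro avg_mat_symmetric) auto
  ultimately have "hessian d (avg_moreau d n A b \<gamma>) (0\<^sub>v d) = avg_mat d n ?D"
    by (intro hessian_quad[OF avg_mat_carrier _ vec_carrier]) auto
  thus ?thesis using False by (simp add: curvature_def)
qed

section \<open>Minimizing the cost\<close>

text \<open>The uniform lower bound makes the infimum positive, so twice the infimum lies strictly
  above it and is undercut by some point. This takes the place of a compactness argument and of
  continuity of the cost in \<gamma>.\<close>

lemma near_minimizer:
  fixes T :: "real \<Rightarrow> real"
  assumes "J \<noteq> {}" and "\<epsilon> > 0" and "\<And>x. x \<in> J \<Longrightarrow> \<epsilon> \<le> T x"
  obtains x where "x \<in> J" and "\<And>y. y \<in> J \<Longrightarrow> T x \<le> 2 * T y"
proof -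
  have bdd: "bdd_below (T ` J)" using assms(3) by (auto intro!: bdd_belowI)
  have "\<epsilon> \<le> Inf (T ` J)" using assms by (intro cINF_greatest) auto
  hence "Inf (T ` J) < 2 * Inf (T ` J)" using assms(2) by simp
  then obtain x where x: "x \<in> J" "T x < 2 * Inf (T ` J)"
    using cInf_lessD[of "T ` J" "2 * Inf (T ` J)"] assms(1) by auto
  have "T x \<le> 2 * T y" if "y \<in> J" for y
    using x(2) cINF_lower[OF bdd that] by simp
  with x(1) show thesis by (rule that)
qed

text \<open>\<open>LS\<close> and \<open>mu\<close> stand for \<open>L_\<gamma>,S\<close> and \<open>\<mu>_\<gamma>\<^sup>+\<close> as functions of \<open>\<gamma>\<close>, and \<open>lam\<close> for the minimum of the
  \<open>\<lambda>_min\<^sup>+(A\<^sub>i)\<close>.\<close>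

locale cost_model =
  fixes LS mu :: "real \<Rightarrow> real" and L lam \<eta> \<tau> :: real
  assumes lam: "0 < lam" "lam \<le> L" and \<eta>: "0 \<le> \<eta>" and \<tau>: "0 < \<tau>"
    and LS_pos: "\<And>g. 0 \<le> g \<Longrightarrow> 0 < LS g"
    and mu_pos: "\<And>g. 0 \<le> g \<Longrightarrow> 0 < mu g"
    and LS_anti: "\<And>g h. 0 \<le> g \<Longrightarrow> g \<le> h \<Longrightarrow> LS h \<le> LS g"
    and mu_anti: "\<And>g h. 0 \<le> g \<Longrightarrow> g \<le> h \<Longrightarrow> mu h \<le> mu g"
    and LS_mono: "\<And>g h. 0 \<le> g \<Longrightarrow> g \<le> h \<Longrightarrow> (1 + g * L) * LS g \<le> (1 + h * L) * LS h"
    and mu_mono: "\<And>g h. 0 \<le> g \<Longrightarrow> g \<le> h \<Longrightarrow> (1 + g * L) * mu g \<le> (1 + h * L) * mu h"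
    and mu_decay: "\<And>g. 1 / lam \<le> g \<Longrightarrow> g * mu g \<le> 2 * (1 / lam * mu (1 / lam))"
begin

definition cost :: "real \<Rightarrow> real" where
  "cost g = (\<eta> + \<tau> * (g * L + 1)) * (LS g / mu g)"

lemma L_pos: "0 < L" using lam by simp

lemma ratio_pos: "0 \<le> g \<Longrightarrow> 0 < LS g / mu g"
  using LS_pos mu_pos by simp

lemma cost_pos: assumes "0 \<le> g" shows "0 < cost g"
proof -
  have "0 < \<tau> * (g * L + 1)" using assms \<tau> L_pos by (simp add: add_nonneg_pos)
  hence "0 < \<eta> + \<tau> * (g * L + 1)" using \<eta> by simp
  thus ?thesis unfolding cost_def using ratio_pos[OF assms] by (rule mult_pos_pos)
qed

text \<open>On this range \<open>1 + g * L\<close> lies between 1 and 2. Moving to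
  \<open>1 / L\<close> thus at most doubles the price of a step and at most halves
  \<open>mu\<close>, while \<open>LS\<close> does not increase.\<close>

lemma cost_below_inverse_L:
  assumes "0 \<le> g" "g \<le> 1 / L"
  shows "cost (1 / L) \<le> 4 * cost g"
proof -
  have m: "mu g \<le> 2 * mu (1 / L)"
  proof -
    have "1 * mu g \<le> (1 + g * L) * mu g"
      using assms L_pos mu_pos[of g] by (intro mult_right_mono) auto
    with mu_mono[OF assms] L_pos show ?thesis by simp
  qed
  have r: "LS (1 / L) / mu (1 / L) \<le> 2 * (LS g / mu g)"
  proof -
    have "LS (1 / L) / mu (1 / L) \<le> LS g / (mu g / 2)"
      using LS_anti[OF assms] m assms L_pos LS_pos[of g] mu_pos[of g]
      by (intro frac_le) auto
    thus ?thesis by (simp add: mult.commute)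
  qed
  have c: "\<eta> + \<tau> * (1 / L * L + 1) \<le> 2 * (\<eta> + \<tau> * (g * L + 1))"
    using \<eta> \<tau> L_pos assms by (simp add: algebra_simps)
  have "cost (1 / L) \<le> (2 * (\<eta> + \<tau> * (g * L + 1))) * (2 * (LS g / mu g))"
    unfolding cost_def using r c ratio_pos[of "1 / L"] \<eta> \<tau> L_pos assms
    by (intro mult_mono) auto
  also have "\<dots> = 4 * cost g" by (simp add: cost_def)
  finally show ?thesis .
qed

text \<open>The numerator \<open>(1 + g * L) * LS g\<close> is monotone in \<open>g\<close> and the
  denominator \<open>mu g\<close> is antitone.\<close>

lemma ratio_beyond:
  assumes "0 \<le> g" "g \<le> h"
  shows "(1 + g * L) * (LS g / mu g) \<le> (1 + h * L) * (LS h / mu h)"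
proof -
  have "0 < 1 + g * L" using assms L_pos by (simp add: add_pos_nonneg)
  hence "(1 + g * L) * LS g / mu g \<le> (1 + h * L) * LS h / mu h"
    using LS_mono[OF assms] mu_anti[OF assms] LS_pos[of h] mu_pos[of h] assms L_pos
    by (intro frac_le) (auto intro: mult_nonneg_nonneg)
  thus ?thesis by simp
qed

text \<open>Dropping the fixed price \<eta> from \<open>cost h\<close> leaves \<tau> times the
  monotone quantity of \<open>ratio_beyond\<close>.\<close>

lemma cost_lower:
  assumes "0 \<le> g" "g \<le> h"
  shows "\<tau> * ((1 + g * L) * (LS g / mu g)) \<le> cost h"
proof -
  have "\<tau> * ((1 + g * L) * (LS g / mu g)) \<le> \<tau> * ((1 + h * L) * (LS h / mu h))"
    using ratio_beyond[OF assms] \<tau> by (intro mult_left_mono) auto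
  also have "\<dots> = (\<tau> * (1 + h * L)) * (LS h / mu h)" by (rule mult.assoc[symmetric])
  also have "\<dots> \<le> cost h" unfolding cost_def
    using \<eta> ratio_pos[of h] assms by (intro mult_right_mono) (auto simp: add.commute)
  finally show ?thesis .
qed

text \<open>At this point the \<gamma>-dependent price \<open>\<tau> * (g * L + 1)\<close> equals
  \<eta>, so the cost is exactly twice the lower bound given by \<open>cost_lower\<close>.\<close>

lemma cost_beyond_price:
  assumes "\<eta> \<ge> \<tau>" "(\<eta> / \<tau> - 1) / L \<le> h"
  shows "cost ((\<eta> / \<tau> - 1) / L) \<le> 2 * cost h"
proof -
  let ?g = "(\<eta> / \<tau> - 1) / L"
  have g: "0 \<le> ?g" using assms \<tau> L_pos by simp
  have e: "?g * L = \<eta> / \<tau> - 1" using L_pos by simp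
  have "cost ?g = 2 * (\<tau> * ((1 + ?g * L) * (LS ?g / mu ?g)))"
    unfolding cost_def e using \<tau> by (simp add: field_simps)
  with cost_lower[OF g assms(2)] show ?thesis by simp
qed

text \<open>Here the fixed price is at most the price \<tau> already paid at 0, so 0 takes over the
  role of the balance point.\<close>

lemma cost_zero: assumes "\<eta> \<le> \<tau>" "0 \<le> h" shows "cost 0 \<le> 2 * cost h"
proof -
  have "cost 0 \<le> (2 * \<tau>) * (LS 0 / mu 0)"
    unfolding cost_def using assms ratio_pos[of 0] by (intro mult_right_mono) auto
  also have "\<dots> = 2 * (\<tau> * ((1 + 0 * L) * (LS 0 / mu 0)))" by simp
  also have "\<dots> \<le> 2 * cost h" using cost_lower[of 0 h] assms by simp
  finally show ?thesis .
qed

text \<open>Write \<open>LS g / mu g\<close> as \<open>(g * LS g) / (g * mu g)\<close>: the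
  numerator does not decrease beyond \<open>1 / lam\<close>, the denominator at most doubles, and
  the price of a step does not decrease.\<close>

lemma cost_beyond_inverse_lam:
  assumes "1 / lam \<le> h"
  shows "cost (1 / lam) \<le> 2 * cost h"
proof -
  let ?g = "1 / lam"
  have g: "0 < ?g" using lam by simp
  hence h: "0 < h" using assms by linarith
  \<comment> \<open>Monotonicity of \<open>g / (1 + g * L)\<close>, cleared of denominators.
    Combined with \<open>LS_mono\<close> it makes \<open>g * LS g\<close> nondecreasing.\<close>
  have "?g * (1 + h * L) \<le> h * (1 + ?g * L)" using assms by (simp add: algebra_simps)
  hence "?g * ((1 + h * L) * LS h) \<le> h * (1 + ?g * L) * LS h"
    using LS_pos[of h] h by (subst mult.assoc[symmetric], intro mult_right_mono) auto
  moreover have "?g * ((1 + ?g * L) * LS ?g) \<le> ?g * ((1 + h * L) * LS h)"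
    using LS_mono[of ?g h] g assms by (intro mult_left_mono) auto
  ultimately have "(1 + ?g * L) * (?g * LS ?g) \<le> (1 + ?g * L) * (h * LS h)"
    by (simp only: mult_ac)
  moreover have "0 < 1 + ?g * L" using g L_pos by (simp add: add_pos_nonneg)
  ultimately have l: "?g * LS ?g \<le> h * LS h"
    by (simp only: mult_le_cancel_left_pos)
  have "LS ?g / mu ?g = (?g * LS ?g) / (?g * mu ?g)" using g by simp
  also have "\<dots> \<le> (h * LS h) / (h * mu h / 2)"
    using l mu_decay[OF assms] g h LS_pos[of ?g] LS_pos[of h] mu_pos[of h]
    by (intro frac_le) (simp_all add: mult.commute)
  also have "\<dots> = 2 * (LS h / mu h)" using h by simp
  finally have r: "LS ?g / mu ?g \<le> 2 * (LS h / mu h)" .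
  have c: "\<eta> + \<tau> * (?g * L + 1) \<le> \<eta> + \<tau> * (h * L + 1)"
    using assms \<tau> L_pos by (intro add_left_mono mult_left_mono add_right_mono mult_right_mono) auto
  have "cost ?g \<le> (\<eta> + \<tau> * (h * L + 1)) * (2 * (LS h / mu h))"
    unfolding cost_def using r c ratio_pos[of ?g] \<eta> \<tau> L_pos g h
    by (intro mult_mono) auto
  also have "\<dots> = 2 * cost h" by (simp add: cost_def)
  finally show ?thesis .
qed

lemma cost_beyond_min:
  assumes "\<eta> \<ge> \<tau>" "min ((\<eta> / \<tau> - 1) / L) (1 / lam) \<le> h"
  shows "cost (min ((\<eta> / \<tau> - 1) / L) (1 / lam)) \<le> 2 * cost h"
  using cost_beyond_price[of h] cost_beyond_inverse_lam[of h] assms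
  by (cases "(\<eta> / \<tau> - 1) / L \<le> 1 / lam") (auto simp: min_def)

text \<open>A point optimal in the interval up to a factor 2 is compared with the endpoints, each of
  which is within a factor 4 of every point on its outer side; hence 8.\<close>

lemma approx_minimizer:
  assumes a: "0 \<le> a" "a \<le> m"
    and left: "\<And>h. 0 \<le> h \<Longrightarrow> h \<le> a \<Longrightarrow> cost a \<le> 4 * cost h"
    and right: "\<And>h. m \<le> h \<Longrightarrow> cost m \<le> 4 * cost h"
  shows "\<exists>g \<in> {a..m}. \<forall>h \<ge> 0. cost g \<le> 8 * cost h"
proof -
  have "\<tau> * (LS 0 / mu 0) \<le> cost x" if "x \<in> {a..m}" for x
    using cost_lower[of 0 x] that a by simp
  moreover have "0 < \<tau> * (LS 0 / mu 0)" using \<tau> ratio_pos[of 0] by (intro mult_pos_pos) auto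
  ultimately obtain g where g: "g \<in> {a..m}" "\<And>y. y \<in> {a..m} \<Longrightarrow> cost g \<le> 2 * cost y"
    using near_minimizer[of "{a..m}" "\<tau> * (LS 0 / mu 0)" cost] a by auto
  have "cost g \<le> 8 * cost h" if h: "0 \<le> h" for h
  proof -
    consider "h \<le> a" | "h \<in> {a..m}" | "m \<le> h" by fastforce
    thus ?thesis
      using left[OF h] right[of h] g(2)[of a] g(2)[of m] g(2)[of h] cost_pos[OF h] a
      by cases auto
  qed
  with g(1) show ?thesis by blast
qed

lemma approx_minimizer_expensive:
  assumes "\<eta> / \<tau> \<ge> 2"
  shows "\<exists>g \<in> {1 / L .. min ((\<eta> / \<tau> - 1) / L) (1 / lam)}. \<forall>h \<ge> 0. cost g \<le> 8 * cost h"
proof (rule approx_minimizer)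
  have le: "\<tau> \<le> \<eta>" using assms \<tau> by (simp add: field_simps)
  \<comment> \<open>The interval is nonempty: \<open>\<eta> / \<tau> - 1\<close> is at least 1, and
    \<open>lam \<le> L\<close>.\<close>
  show "1 / L \<le> min ((\<eta> / \<tau> - 1) / L) (1 / lam)"
    using assms lam L_pos by (auto intro!: divide_right_mono divide_left_mono)
  show "cost (min ((\<eta> / \<tau> - 1) / L) (1 / lam)) \<le> 4 * cost h"
    if h: "min ((\<eta> / \<tau> - 1) / L) (1 / lam) \<le> h" for h
  proof -
    have "0 \<le> min ((\<eta> / \<tau> - 1) / L) (1 / lam)" using assms lam L_pos by simp
    with h have "0 \<le> h" by linarith
    from cost_beyond_min[OF le h] cost_pos[OF this] show ?thesis by simp
  qed
qed (use L_pos cost_below_inverse_L in auto)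

text \<open>Nothing lies to the left of 0. If \<open>\<eta> < \<tau>\<close>, the balance point is
  negative, the interval collapses to 0, and \<open>cost_zero\<close> replaces
  \<open>cost_beyond_min\<close>.\<close>

lemma approx_minimizer_cheap:
  "\<exists>g \<in> {0 .. max 0 (min ((\<eta> / \<tau> - 1) / L) (1 / lam))}. \<forall>h \<ge> 0. cost g \<le> 8 * cost h"
proof (rule approx_minimizer)
  show "cost 0 \<le> 4 * cost h" if "0 \<le> h" "h \<le> 0" for h
    using that cost_pos[of 0] by simp
  show "cost (max 0 (min ((\<eta> / \<tau> - 1) / L) (1 / lam))) \<le> 4 * cost h"
    if h: "max 0 (min ((\<eta> / \<tau> - 1) / L) (1 / lam)) \<le> h" for h
  proof (cases "\<tau> \<le> \<eta>")
    case True
    hence "max 0 (min ((\<eta> / \<tau> - 1) / L) (1 / lam)) = min ((\<eta> / \<tau> - 1) / L) (1 / lam)"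
      using \<tau> lam L_pos by (intro max_absorb2) auto
    moreover have "0 \<le> h" using h by simp
    ultimately show ?thesis using cost_beyond_min[OF True, of h] cost_pos[of h] h by simp
  next
    case False
    hence "(\<eta> / \<tau> - 1) / L \<le> 0" using \<tau> L_pos by (simp add: field_simps)
    hence "max 0 (min ((\<eta> / \<tau> - 1) / L) (1 / lam)) = 0" by auto
    with cost_zero[of h] cost_pos[of h] False h show ?thesis by auto
  qed
qed auto

end

section \<open>Scalar inequalities for shrunk eigenvalues\<close>

lemma shrink_antimono:
  assumes "0 \<le> t" "0 \<le> g" "g \<le> (h :: real)"
  shows "t / (1 + h * t) \<le> t / (1 + g * t)"
  using assms by (intro divide_left_mono add_left_mono mult_right_mono mult_pos_pos add_pos_nonneg) auto

text \<open>For \<open>g \<le> h\<close> the ratio \<open>(1 + h * t) / (1 + g * t)\<close> is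
  nondecreasing in \<open>t\<close>, so its value at \<open>t = L\<close> bounds it.\<close>

lemma shrink_mono:
  assumes "0 \<le> t" "t \<le> L" "0 \<le> g" "g \<le> (h :: real)"
  shows "t / (1 + g * t) \<le> (1 + h * L) / (1 + g * L) * (t / (1 + h * t))"
proof -
  have pos: "0 < 1 + g * t" "0 < 1 + g * L" "0 < 1 + h * t"
    using assms by (auto intro!: add_pos_nonneg)
  have "0 \<le> (h - g) * (L - t)" using assms by simp
  hence "(1 + g * L) * (1 + h * t) \<le> (1 + h * L) * (1 + g * t)" by (simp add: algebra_simps)
  hence "t * ((1 + g * L) * (1 + h * t)) \<le> t * ((1 + h * L) * (1 + g * t))"
    using assms(1) by (rule mult_left_mono)
  thus ?thesis using pos by (simp add: divide_simps mult_ac)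
qed

text \<open>A crude bound for \<open>g\<close> and \<open>h\<close> in either order, obtained by
  passing through the value at 0. It supplies the converse comparison by which
  \<open>lambda_min_pos_mono\<close> identifies kernels.\<close>

lemma shrink_bounded_ratio:
  assumes "0 \<le> t" "t \<le> L" "0 \<le> g" "0 \<le> (h :: real)"
  shows "t / (1 + g * t) \<le> (1 + h * L) * (t / (1 + h * t))"
proof -
  have "t / (1 + g * t) \<le> t / (1 + 0 * t)" by (rule shrink_antimono) (use assms in auto)
  also have "\<dots> \<le> (1 + h * L) / (1 + 0 * L) * (t / (1 + h * t))"
    by (rule shrink_mono) (use assms in auto)
  finally show ?thesis by simp
qed

text \<open>\<open>h * t / (1 + h * t)\<close> is at most 1, whereas at \<open>h = 1 / lam\<close>
  it is at least 1/2 as soon as \<open>lam \<le> t\<close>. The quotient of these bounds gives the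
  factor 2.\<close>

lemma shrink_decay:
  assumes "t = 0 \<or> lam \<le> t" "0 < lam" "1 / lam \<le> (h :: real)"
  shows "t / (1 + h * t) \<le> 2 / (lam * h) * (t / (1 + 1 / lam * t))"
proof (cases "t = 0")
  case False
  hence t: "lam \<le> t" using assms by simp
  have h: "0 < h" using assms by (meson less_le_trans zero_less_divide_1_iff)
  have "t / (1 + h * t) \<le> 1 / h" using h t assms(2) by (simp add: divide_simps add_pos_pos)
  also have "\<dots> = 2 / (lam * h) * (lam / 2)" using assms(2) by simp
  also have "\<dots> \<le> 2 / (lam * h) * (t / (1 + 1 / lam * t))"
    using t assms(2) h by (intro mult_left_mono) (auto simp: field_simps)
  finally show ?thesis .
qed simp

section \<open>The averaged envelopes as an instance of the cost model\<close>

lemma quadratic_form_zero_mat: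
  fixes x :: "real vec"
  assumes "x \<in> carrier_vec n"
  shows "x \<bullet> (0\<^sub>m n n *\<^sub>v x) = 0"
proof -
  have "0\<^sub>m n n *\<^sub>v x = 0\<^sub>v n" using assms by (intro eq_vecI) auto
  thus ?thesis using assms by simp
qed

text \<open>The monotonicity and decay assumptions come from the scalar inequalities, applied to all
  eigenvalues of all \<open>A i\<close>, summed into quadratic forms, and passed on to the extreme
  eigenvalues of the average.\<close>

lemma cost_model_time_complexity:
  assumes n: "2 \<le> n" and S: "S \<in> {1..n}" and psd: "\<forall>i \<in> {1..n}. psd d (A i)"
    and b: "\<forall>i \<in> {1..n}. b i \<in> carrier_vec d" and nz: "\<exists>i \<in> {1..n}. A i \<noteq> 0\<^sub>m d d"
    and \<eta>: "0 \<le> \<eta>" and \<tau>: "0 < \<tau>"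
  shows "cost_model (L_gamma_S d n A b S) (mu_gamma d n A b) (L_max n A) (min_lambda_min_pos d n A) \<eta> \<tau>"
proof -
  obtain k where k: "k \<in> {1..n}" "A k \<noteq> 0\<^sub>m d d" using nz by auto
  have car: "A i \<in> carrier_mat d d" if "i \<in> {1..n}" for i using psd that by (auto simp: psd_def)
  have d: "0 < d" using car[OF k(1)] k(2) by (cases d) auto
  have "\<exists>P f. orth d P \<and> A i = spectral_mat d P f \<and> (\<forall>j<d. 0 \<le> f j)" if "i \<in> {1..n}" for i
    using psd_spectral_decomposition[of d "A i"] psd that by metis
  then obtain P f where P: "\<And>i. i \<in> {1..n} \<Longrightarrow> orth d (P i)"
    and A: "\<And>i. i \<in> {1..n} \<Longrightarrow> A i = spectral_mat d (P i) (f i)"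
    and f: "\<And>i j. i \<in> {1..n} \<Longrightarrow> j < d \<Longrightarrow> 0 \<le> f i j"
    by metis
  define L where "L = L_max n A"
  define lam where "lam = min_lambda_min_pos d n A"
  have fL: "f i j \<le> L" if "i \<in> {1..n}" "j < d" for i j
  proof -
    have "f i j \<le> lambda_max (A i)"
      using lambda_max_spectral_mat[OF P[OF that(1)] d, of "f i"] A[OF that(1)] that(2) by metis
    also have "\<dots> \<le> L" unfolding L_def L_max_def using that by (intro Max_ge) auto
    finally show ?thesis .
  qed
  have min: "\<exists>j<d. lambda_min_pos (A i) = f i j \<and> 0 < f i j \<and> (\<forall>l<d. f i l = 0 \<or> f i j \<le> f i l)"
    if "i \<in> {1..n}" "A i \<noteq> 0\<^sub>m d d" for i
    by (rule lambda_min_pos_spectral_mat[OF P[OF that(1)], of "f i"]) (use f A that in auto)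
  \<comment> \<open>The minimum defining \<open>lam\<close> skips zero matrices, whose eigenvalues
    are therefore shown to vanish separately.\<close>
  have flam: "f i j = 0 \<or> lam \<le> f i j" if "i \<in> {1..n}" "j < d" for i j
  proof (cases "A i = 0\<^sub>m d d")
    case True
    let ?v = "P i *\<^sub>v unit_vec d j"
    have v: "?v \<in> carrier_vec d" using P[OF that(1)] by simp
    have "f i j = ?v \<bullet> (A i *\<^sub>v ?v)"
      using spectral_mat_eigenvector[OF P[OF that(1)] that(2)] A[OF that(1)] v by simp
    also have "\<dots> = 0" unfolding True by (rule quadratic_form_zero_mat[OF v])
    finally show ?thesis by simp
  next
    case False
    have "lam \<le> lambda_min_pos (A i)"
      unfolding lam_def min_lambda_min_pos_def using that False by (intro Min_le) auto
    thus ?thesis using min[OF that(1) False] that(2) by force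
  qed
  have "lam \<in> (\<lambda>i. lambda_min_pos (A i)) ` {i \<in> {1..n}. A i \<noteq> 0\<^sub>m d d}"
    unfolding lam_def min_lambda_min_pos_def using k by (intro Min_in) auto
  \<comment> \<open>This positive eigenvalue attaining \<open>lam\<close> is kept fixed; its
    eigenvector witnesses below that no \<open>H \<gamma>\<close> is zero.\<close>
  then obtain i j where ij: "i \<in> {1..n}" "j < d" "lam = f i j" "0 < f i j" using min by blast
  hence lam: "0 < lam" "lam \<le> L" using fL by auto
  define D where "D \<gamma> i = spectral_mat d (P i) (\<lambda>j. f i j / (1 + \<gamma> * f i j))" for \<gamma> i
  define H where "H \<gamma> = avg_mat d n (D \<gamma>)" for \<gamma>
  have curv: "curvature d n A b \<gamma> = H \<gamma>" if "0 \<le> \<gamma>" for \<gamma>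
    unfolding H_def D_def[abs_def] using P f A b that by (intro curvature_spectral_mat) auto
  have psdD: "psd d (D \<gamma> i)" if "0 \<le> \<gamma>" "i \<in> {1..n}" for \<gamma> i
    unfolding D_def using P f that by (intro psd_spectral_mat divide_nonneg_nonneg) auto
  hence psdH: "psd d (H \<gamma>)" if "0 \<le> \<gamma>" for \<gamma> unfolding H_def using that by (intro psd_avg_mat) auto
  have form: "x \<bullet> (H \<gamma> *\<^sub>v x)
      = 1 / real n * (\<Sum>i = 1..n. \<Sum>j<d. f i j / (1 + \<gamma> * f i j) * ((transpose_mat (P i) *\<^sub>v x) $ j)\<^sup>2)"
    if x: "x \<in> carrier_vec d" for x \<gamma>
  proof -
    have "x \<bullet> (H \<gamma> *\<^sub>v x) = 1 / real n * (\<Sum>i = 1..n. x \<bullet> (D \<gamma> i *\<^sub>v x))"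
      unfolding H_def using P x by (intro avg_mat_quadratic_form) (auto simp: D_def)
    also have "(\<Sum>i = 1..n. x \<bullet> (D \<gamma> i *\<^sub>v x))
        = (\<Sum>i = 1..n. \<Sum>j<d. f i j / (1 + \<gamma> * f i j) * ((transpose_mat (P i) *\<^sub>v x) $ j)\<^sup>2)"
      unfolding D_def using P x by (intro sum.cong refl spectral_mat_quadratic_form) auto
    finally show ?thesis .
  qed
  \<comment> \<open>The bases \<open>P i\<close> do not depend on \<gamma>, so both forms are sums
    over the same squared coordinates and can be compared term by term.\<close>
  have compare: "x \<bullet> (H g *\<^sub>v x) \<le> c * (x \<bullet> (H h *\<^sub>v x))"
    if x: "x \<in> carrier_vec d"
      and le: "\<And>i j. i \<in> {1..n} \<Longrightarrow> j < d \<Longrightarrow> f i j / (1 + g * f i j) \<le> c * (f i j / (1 + h * f i j))"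
    for x g h c
  proof -
    have "(\<Sum>i = 1..n. \<Sum>j<d. f i j / (1 + g * f i j) * ((transpose_mat (P i) *\<^sub>v x) $ j)\<^sup>2)
      \<le> (\<Sum>i = 1..n. \<Sum>j<d. c * (f i j / (1 + h * f i j)) * ((transpose_mat (P i) *\<^sub>v x) $ j)\<^sup>2)"
      using le by (intro sum_mono mult_right_mono) auto
    also have "\<dots> = c * (\<Sum>i = 1..n. \<Sum>j<d. f i j / (1 + h * f i j) * ((transpose_mat (P i) *\<^sub>v x) $ j)\<^sup>2)"
      by (simp only: sum_distrib_left mult.assoc)
    finally have "1 / real n * (\<Sum>i = 1..n. \<Sum>j<d. f i j / (1 + g * f i j) * ((transpose_mat (P i) *\<^sub>v x) $ j)\<^sup>2)
      \<le> 1 / real n * (c * (\<Sum>i = 1..n. \<Sum>j<d. f i j / (1 + h * f i j) * ((transpose_mat (P i) *\<^sub>v x) $ j)\<^sup>2))"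
      by (intro mult_left_mono) auto
    thus ?thesis unfolding form[OF x] by (simp only: mult_ac)
  qed
  have pos: "0 < v \<bullet> (H \<gamma> *\<^sub>v v)" if v: "v = P i *\<^sub>v unit_vec d j" and g: "0 \<le> \<gamma>" for v \<gamma>
  proof -
    have vc: "v \<in> carrier_vec d" using P[OF ij(1)] v by simp
    have "0 < f i j / (1 + \<gamma> * f i j)" using ij g by (auto intro!: divide_pos_pos add_pos_nonneg)
    also have "\<dots> = v \<bullet> (D \<gamma> i *\<^sub>v v)"
      using spectral_mat_eigenvector[OF P[OF ij(1)] ij(2)] vc by (simp add: D_def v)
    also have "\<dots> \<le> (\<Sum>i = 1..n. v \<bullet> (D \<gamma> i *\<^sub>v v))"
      using ij(1) psdD[OF g] vc by (intro member_le_sum) (auto simp: psd_def)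
    finally have "0 < 1 / real n * (\<Sum>i = 1..n. v \<bullet> (D \<gamma> i *\<^sub>v v))" using n by simp
    also have "\<dots> = v \<bullet> (H \<gamma> *\<^sub>v v)"
      unfolding H_def using P vc by (intro avg_mat_quadratic_form[symmetric]) (auto simp: D_def)
    finally show ?thesis .
  qed
  have H0: "H \<gamma> \<noteq> 0\<^sub>m d d" if "0 \<le> \<gamma>" for \<gamma>
    using pos[OF refl that] quadratic_form_zero_mat[OF orth_mult_vec_carrier(1)[OF P[OF ij(1)] unit_vec_carrier]] by force
  have mu: "mu_gamma d n A b \<gamma> = lambda_min_pos (H \<gamma>)" and Lg: "L_gamma d n A b \<gamma> = lambda_max (H \<gamma>)"
    if "0 \<le> \<gamma>" for \<gamma> using that by (simp_all add: mu_gamma_def L_gamma_def curv)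
  have mu_pos: "0 < mu_gamma d n A b \<gamma>" if "0 \<le> \<gamma>" for \<gamma>
    using lambda_min_pos_eigenvector[OF psdH[OF that] H0[OF that]] mu[OF that] by metis
  have Lg_pos: "0 < L_gamma d n A b \<gamma>" if g: "0 \<le> \<gamma>" for \<gamma>
  proof -
    let ?v = "P i *\<^sub>v unit_vec d j"
    have "?v \<in> carrier_vec d" using P[OF ij(1)] by simp
    from rayleigh_le_lambda_max[OF psdH[OF g] this d] pos[OF refl g]
    have "0 < lambda_max (H \<gamma>) * (?v \<bullet> ?v)" by linarith
    thus ?thesis using spectral_mat_eigenvector(2)[OF P[OF ij(1)] ij(2)] Lg[OF g] by simp
  qed
  have Lg_le: "L_gamma d n A b g \<le> c * L_gamma d n A b h"
    if g: "0 \<le> g" "0 \<le> h" "0 \<le> c"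
      and le: "\<And>i j. i \<in> {1..n} \<Longrightarrow> j < d \<Longrightarrow> f i j / (1 + g * f i j) \<le> c * (f i j / (1 + h * f i j))"
    for g h c
  proof -
    have "x \<bullet> (H g *\<^sub>v x) \<le> c * (x \<bullet> (H h *\<^sub>v x))" if "x \<in> carrier_vec d" for x
      by (rule compare[OF that le])
    from lambda_max_mono[OF psdH[OF g(1)] psdH[OF g(2)] d this g(3)]
    show ?thesis unfolding Lg[OF g(1)] Lg[OF g(2)] .
  qed
  have mu_le: "mu_gamma d n A b g \<le> c * mu_gamma d n A b h"
    if g: "0 \<le> g" "0 \<le> h"
      and le: "\<And>i j. i \<in> {1..n} \<Longrightarrow> j < d \<Longrightarrow> f i j / (1 + g * f i j) \<le> c * (f i j / (1 + h * f i j))"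
    for g h c
  proof -
    \<comment> \<open>The converse comparison, with \<open>g\<close> and \<open>h\<close> exchanged;
      its constant \<open>1 + g * L\<close> does not enter the conclusion.\<close>
    note ge = shrink_bounded_ratio[OF f fL g(2,1)]
    have "x \<bullet> (H g *\<^sub>v x) \<le> c * (x \<bullet> (H h *\<^sub>v x))"
      "x \<bullet> (H h *\<^sub>v x) \<le> (1 + g * L) * (x \<bullet> (H g *\<^sub>v x))" if "x \<in> carrier_vec d" for x
      by (rule compare[OF that le], assumption+) (rule compare[OF that ge])
    from lambda_min_pos_mono[OF psdH[OF g(1)] psdH[OF g(2)] H0[OF g(1)] H0[OF g(2)] this]
    show ?thesis unfolding mu[OF g(1)] mu[OF g(2)] .
  qed
  have L: "0 < L" using lam by simp
  have den: "0 < 1 + g * L" if "0 \<le> g" for g using that L by (simp add: add_pos_nonneg)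
  have anti: "L_gamma d n A b h \<le> L_gamma d n A b g" "mu_gamma d n A b h \<le> mu_gamma d n A b g"
    if "0 \<le> g" "g \<le> h" for g h
    using Lg_le[of h g 1] mu_le[of h g 1] shrink_antimono[OF f that] that by auto
  have mono: "(1 + g * L) * L_gamma d n A b g \<le> (1 + h * L) * L_gamma d n A b h"
    "(1 + g * L) * mu_gamma d n A b g \<le> (1 + h * L) * mu_gamma d n A b h"
    if gh: "0 \<le> g" "g \<le> h" for g h
  proof -
    have h: "0 \<le> h" using gh by simp
    have c: "0 \<le> (1 + h * L) / (1 + g * L)" using den[OF h] den[OF gh(1)] by simp
    note le = shrink_mono[OF f fL gh]
    show "(1 + g * L) * L_gamma d n A b g \<le> (1 + h * L) * L_gamma d n A b h"
    proof -
      have "L_gamma d n A b g \<le> (1 + h * L) / (1 + g * L) * L_gamma d n A b h"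
        by (rule Lg_le[OF gh(1) h c le])
      thus ?thesis using den[OF gh(1)] by (simp add: pos_le_divide_eq mult.commute)
    qed
    show "(1 + g * L) * mu_gamma d n A b g \<le> (1 + h * L) * mu_gamma d n A b h"
    proof -
      have "mu_gamma d n A b g \<le> (1 + h * L) / (1 + g * L) * mu_gamma d n A b h"
        by (rule mu_le[OF gh(1) h le])
      thus ?thesis using den[OF gh(1)] by (simp add: pos_le_divide_eq mult.commute)
    qed
  qed
  define p where "p = (real n - real S) / (real S * (real n - 1))"
  define q where "q = real n * (real S - 1) / (real S * (real n - 1))"
  \<comment> \<open>\<open>p\<close> vanishes only for \<open>S = n\<close> and \<open>q\<close>
    only for \<open>S = 1\<close>; as \<open>n\<close> is at least 2, they never vanish
    together.\<close>
  have p: "0 \<le> p" and q: "0 \<le> q" and pq: "0 < p \<or> 0 < q"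
    using n S by (cases "S = 1"; auto simp: p_def q_def)+
  have LS: "L_gamma_S d n A b S \<gamma> = p * (L / (1 + \<gamma> * L)) + q * L_gamma d n A b \<gamma>" for \<gamma>
    by (simp add: L_gamma_S_def p_def q_def L_def)
  show ?thesis
    unfolding L_def[symmetric] lam_def[symmetric]
  proof
    fix g :: real assume g: "0 \<le> g"
    have "0 < L / (1 + g * L)" using L den[OF g] by simp
    thus "0 < L_gamma_S d n A b S g"
      unfolding LS using pq mult_pos_pos[of p "L / (1 + g * L)"] mult_pos_pos[OF _ Lg_pos[OF g], of q]
        mult_nonneg_nonneg[OF p, of "L / (1 + g * L)"] mult_nonneg_nonneg[OF q, of "L_gamma d n A b g"] Lg_pos[OF g]
      by linarith
  next
    fix g h :: real assume gh: "0 \<le> g" "g \<le> h"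
    have h: "0 \<le> h" using gh by simp
    have "L / (1 + h * L) \<le> L / (1 + g * L)" using shrink_antimono[of L g h] L gh by simp
    thus "L_gamma_S d n A b S h \<le> L_gamma_S d n A b S g"
      unfolding LS using p q anti(1)[OF gh] by (intro add_mono mult_left_mono)
    \<comment> \<open>Multiplication by \<open>1 + g * L\<close> turns the first summand into the
      constant \<open>p * L\<close>, leaving only the monotonicity of the second.\<close>
    have e: "(1 + g * L) * L_gamma_S d n A b S g = p * L + q * ((1 + g * L) * L_gamma d n A b g)"
      if "0 \<le> g" for g
      unfolding LS using den[OF that] by (simp add: distrib_left)
    show "(1 + g * L) * L_gamma_S d n A b S g \<le> (1 + h * L) * L_gamma_S d n A b S h"
      unfolding e[OF gh(1)] e[OF h] using q mono(1)[OF gh] by (intro add_left_mono mult_left_mono)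
  next
    fix g :: real assume g: "1 / lam \<le> g"
    have l: "0 < 1 / lam" using lam by simp
    hence "0 < g" using g by linarith
    hence "mu_gamma d n A b g \<le> 2 / (lam * g) * mu_gamma d n A b (1 / lam)"
      using l shrink_decay[OF flam lam(1) g] by (intro mu_le) auto
    thus "g * mu_gamma d n A b g \<le> 2 * (1 / lam * mu_gamma d n A b (1 / lam))"
      using \<open>0 < g\<close> lam(1) by (simp add: field_simps)
  qed (use lam \<eta> \<tau> mu_pos anti mono in auto)
qed

theorem theorem5p2:
  shows "\<exists>C::real. C > 0 \<and>
    (\<forall>(d::nat) (n::nat) (S::nat) (A :: nat \<Rightarrow> real mat) (b :: nat \<Rightarrow> real vec) (\<eta>::real) (\<tau>::real).
      n \<ge> 2 \<longrightarrow> S \<in> {1..n} \<longrightarrow>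
      (\<forall>i \<in> {1..n}. psd d (A i)) \<longrightarrow> (\<forall>i \<in> {1..n}. b i \<in> carrier_vec d) \<longrightarrow>
      (\<exists>i \<in> {1..n}. A i \<noteq> 0\<^sub>m d d) \<longrightarrow>
      (\<exists>xs \<in> carrier_vec d. \<forall>i \<in> {1..n}. grad d (quad (A i) (b i)) xs = 0\<^sub>v d) \<longrightarrow>
      \<eta> \<ge> 0 \<longrightarrow> \<tau> > 0 \<longrightarrow>
      (\<eta> / \<tau> \<ge> 2 \<longrightarrow>
        (\<exists>\<gamma> \<in> {1 / L_max n A ..
                min ((\<eta> / \<tau> - 1) / L_max n A) (1 / min_lambda_min_pos d n A)}.
          time_complexity d n A b \<eta> \<tau> \<gamma> S
            \<le> C * (INF \<gamma>' \<in> {0..}. time_complexity d n A b \<eta> \<tau> \<gamma>' S))) \<and>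
      (\<eta> / \<tau> < 2 \<longrightarrow>
        (\<exists>\<gamma> \<in> {0 ..
                max 0 (min ((\<eta> / \<tau> - 1) / L_max n A) (1 / min_lambda_min_pos d n A))}.
          time_complexity d n A b \<eta> \<tau> \<gamma> S
            \<le> C * (INF \<gamma>' \<in> {0..}. time_complexity d n A b \<eta> \<tau> \<gamma>' S))))"
proof (intro exI[of _ "8 :: real"] conjI allI impI)
  fix d n S :: nat and A :: "nat \<Rightarrow> real mat" and b :: "nat \<Rightarrow> real vec" and \<eta> \<tau> :: real
  assume data: "2 \<le> n" "S \<in> {1..n}" "\<forall>i \<in> {1..n}. psd d (A i)" "\<forall>i \<in> {1..n}. b i \<in> carrier_vec d"
    "\<exists>i \<in> {1..n}. A i \<noteq> 0\<^sub>m d d" "0 \<le> \<eta>" "0 < \<tau>"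
  interpret cost_model "L_gamma_S d n A b S" "mu_gamma d n A b" "L_max n A" "min_lambda_min_pos d n A" \<eta> \<tau>
    by (rule cost_model_time_complexity[OF data])
  let ?T = "\<lambda>\<gamma>. time_complexity d n A b \<eta> \<tau> \<gamma> S"
  have T: "?T \<gamma> = cost \<gamma>" for \<gamma> by (simp add: time_complexity_def cost_def)
  \<comment> \<open>The pointwise estimate makes \<open>cost \<gamma> / 8\<close> a lower bound of
    all costs, hence at most their infimum.\<close>
  have inf: "?T \<gamma> \<le> 8 * (INF \<gamma>' \<in> {0..}. ?T \<gamma>')" if "\<forall>h \<ge> 0. cost \<gamma> \<le> 8 * cost h" for \<gamma>
  proof -
    have "cost \<gamma> / 8 \<le> (INF \<gamma>' \<in> {0..}. cost \<gamma>')" using that by (intro cINF_greatest) auto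
    thus ?thesis unfolding T by simp
  qed
  show "\<exists>\<gamma> \<in> {1 / L_max n A .. min ((\<eta> / \<tau> - 1) / L_max n A) (1 / min_lambda_min_pos d n A)}.
      ?T \<gamma> \<le> 8 * (INF \<gamma>' \<in> {0..}. ?T \<gamma>')" if "\<eta> / \<tau> \<ge> 2"
    using approx_minimizer_expensive[OF that] inf by blast
  show "\<exists>\<gamma> \<in> {0 .. max 0 (min ((\<eta> / \<tau> - 1) / L_max n A) (1 / min_lambda_min_pos d n A))}.
      ?T \<gamma> \<le> 8 * (INF \<gamma>' \<in> {0..}. ?T \<gamma>')"
    using approx_minimizer_cheap inf by blast
qed simp

end
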